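(* Let $R$ be a finite commutative ring in which $2$ is a unit, let $\mathbb{K}$ be a ring, let $\mathcal{A}=\mathbf{OrI}(R)$, and let $M$ be a finitely generated $\mathcal{A}$-module over $\mathbb{K}$. Then there exists an integer $N$ such that for every morphism $f:V\to W$ in $\mathcal{A}$ with $\operatorname{rk} V\ge N$, the $\mathbb{K}$-module $M(W)$ is spanned by the orbit of the image of $M(f):M(V)\to M(W)$ under the action of $\mathrm{Aut}_{\mathcal{A}}(W)$ on $M(W)$ (via $M$).
   Context: An orthogonal $R$-module is a pair $(V,B)$ with $V$ a free $R$-module of finite rank $\operatorname{rk}V$ and $B:V\times V\to R$ a symmetric bilinear form that is non-degenerate, i.e. induces an isomorphism $V\to \mathrm{Hom}_R(V,R)$. An isometry $(V,B_V)\to(W,B_W)$ is an $R$-linear map $\phi$ with $B_V(v,w)=B_W(\phi(v),\phi(w))$ for all $v,w$ (not necessarily bijective). $\mathbf{OrI}(R)$ is the category of orthogonal $R$-modules and isometries. An $\mathcal{A}$-module over $\mathbb{K}$ is a functor $M:\mathcal{A}\to\mathbf{Mod}_{\mathbb{K}}$; submodules are defined pointwise. $M$ is finitely generated if there are finitely many objects $V_1,\dots,V_m$ and elements $x_i\in M(V_i)$ such that any submodule $N\subseteq M$ with $x_i\in N(V_i)$ for all $i$ equals $M$. *)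

theory Defs
  imports "HOL-Algebra.Algebra"
begin

section \<open>Modules\<close>

text \<open>
  The library locale \<open>module\<close> requires a commutative base ring. The coefficient ring of a
  representation is an arbitrary ring, so its modules are left modules in the sense below; over a
  commutative ring this is the locale \<open>module\<close>.
\<close>

locale left_module = R?: ring R + M?: abelian_group M
  for R :: "('k, 'c) ring_scheme" (structure) and M :: "('k, 'm, 'd) module_scheme" (structure) +
  assumes smult_closed:
      "\<lbrakk>a \<in> carrier R; x \<in> carrier M\<rbrakk> \<Longrightarrow> a \<odot>\<^bsub>M\<^esub> x \<in> carrier M"
    and smult_l_distr:
      "\<lbrakk>a \<in> carrier R; b \<in> carrier R; x \<in> carrier M\<rbrakk> \<Longrightarrow>
        (a \<oplus> b) \<odot>\<^bsub>M\<^esub> x = a \<odot>\<^bsub>M\<^esub> x \<oplus>\<^bsub>M\<^esub> b \<odot>\<^bsub>M\<^esub> x"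
    and smult_r_distr:
      "\<lbrakk>a \<in> carrier R; x \<in> carrier M; y \<in> carrier M\<rbrakk> \<Longrightarrow>
        a \<odot>\<^bsub>M\<^esub> (x \<oplus>\<^bsub>M\<^esub> y) = a \<odot>\<^bsub>M\<^esub> x \<oplus>\<^bsub>M\<^esub> a \<odot>\<^bsub>M\<^esub> y"
    and smult_assoc1:
      "\<lbrakk>a \<in> carrier R; b \<in> carrier R; x \<in> carrier M\<rbrakk> \<Longrightarrow>
        (a \<otimes> b) \<odot>\<^bsub>M\<^esub> x = a \<odot>\<^bsub>M\<^esub> (b \<odot>\<^bsub>M\<^esub> x)"
    and smult_one:
      "x \<in> carrier M \<Longrightarrow> \<one> \<odot>\<^bsub>M\<^esub> x = x"

definition linear_map ::
  "('r, 'c) ring_scheme \<Rightarrow> ('r, 'v, 'd) module_scheme \<Rightarrow> ('r, 'w, 'e) module_scheme \<Rightarrow> ('v \<Rightarrow> 'w) \<Rightarrow> bool"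
  where
  "linear_map R V W f \<longleftrightarrow>
     f \<in> carrier V \<rightarrow> carrier W \<and>
     (\<forall>x\<in>carrier V. \<forall>y\<in>carrier V. f (x \<oplus>\<^bsub>V\<^esub> y) = f x \<oplus>\<^bsub>W\<^esub> f y) \<and>
     (\<forall>a\<in>carrier R. \<forall>x\<in>carrier V. f (a \<odot>\<^bsub>V\<^esub> x) = a \<odot>\<^bsub>W\<^esub> f x)"

definition submodule_span ::
  "('k, 'c) ring_scheme \<Rightarrow> ('k, 'm, 'd) module_scheme \<Rightarrow> 'm set \<Rightarrow> 'm set" where
  "submodule_span K M S = \<Inter>{H. submodule H K M \<and> S \<subseteq> H}"

definition regular_module :: "('r, 'c) ring_scheme \<Rightarrow> ('r, 'r) module" where
  "regular_module R =
     \<lparr>carrier = carrier R, monoid.mult = monoid.mult R, one = \<one>\<^bsub>R\<^esub>,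
      ring.zero = \<zero>\<^bsub>R\<^esub>, add = add R,
      smult = monoid.mult R\<rparr>"

text \<open>
  Functions defined on the carrier of a module are taken to be extensional (\<open>undefined\<close> off the
  carrier), so that equality of functions is equality of maps.
\<close>

definition dual_space :: "('r, 'c) ring_scheme \<Rightarrow> ('r, 'v, 'd) module_scheme \<Rightarrow> ('v \<Rightarrow> 'r) set" where
  "dual_space R V = {\<phi> \<in> extensional (carrier V). linear_map R V (regular_module R) \<phi>}"

definition is_basis :: "('r, 'c) ring_scheme \<Rightarrow> ('r, 'v, 'd) module_scheme \<Rightarrow> 'v set \<Rightarrow> bool" where
  "is_basis R V B \<longleftrightarrow>
     finite B \<and> B \<subseteq> carrier V \<and>
     (\<forall>v\<in>carrier V. \<exists>!c. c \<in> B \<rightarrow>\<^sub>E carrier R \<and> v = (\<Oplus>\<^bsub>V\<^esub>b\<in>B. c b \<odot>\<^bsub>V\<^esub> b))"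

text \<open>
  All bases of a free module over a nonzero commutative ring have the same cardinality; \<open>LEAST\<close>
  only makes a choice over the zero ring, where every module has rank 0.
\<close>

definition rk :: "('r, 'c) ring_scheme \<Rightarrow> ('r, 'v, 'd) module_scheme \<Rightarrow> nat" where
  "rk R V = (LEAST n. \<exists>B. is_basis R V B \<and> card B = n)"


section \<open>The category of orthogonal modules and isometries\<close>

record ('r, 'v) orthogonal_module = "('r, 'v) module" +
  form :: "'v \<Rightarrow> 'v \<Rightarrow> 'r"

text \<open>
  The objects are the orthogonal modules whose carrier is a set of elements of a type \<open>'v\<close>, which
  remains a parameter. As \<open>R\<close> is going to be finite, all orthogonal modules are finite, so for
  every infinite \<open>'v\<close> this is equivalent to the category of all orthogonal modules.
\<close>

locale orthogonal_module = module R V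
  for R :: "('r, 'c) ring_scheme" (structure) and V :: "('r, 'v) orthogonal_module" (structure) +
  assumes free: "\<exists>B. is_basis R V B"
    and linear: "v \<in> carrier V \<Longrightarrow> linear_map R V (regular_module R) (form V v)"
    and symmetric: "\<lbrakk>v \<in> carrier V; w \<in> carrier V\<rbrakk> \<Longrightarrow> form V v w = form V w v"
    and nondegenerate:
      "bij_betw (\<lambda>v. \<lambda>w\<in>carrier V. form V v w) (carrier V) (dual_space R V)"

definition isometries ::
  "('r, 'c) ring_scheme \<Rightarrow> ('r, 'v) orthogonal_module \<Rightarrow> ('r, 'v) orthogonal_module \<Rightarrow> ('v \<Rightarrow> 'v) set"
  where
  "isometries R V W = {\<phi> \<in> extensional (carrier V). linear_map R V W \<phi> \<and>
     (\<forall>v\<in>carrier V. \<forall>w\<in>carrier V. form V v w = form W (\<phi> v) (\<phi> w))}"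

definition automorphisms ::
  "('r, 'c) ring_scheme \<Rightarrow> ('r, 'v) orthogonal_module \<Rightarrow> ('v \<Rightarrow> 'v) set" where
  "automorphisms R W = {g \<in> isometries R W W. \<exists>h\<in>isometries R W W.
     compose (carrier W) g h = (\<lambda>w\<in>carrier W. w) \<and>
     compose (carrier W) h g = (\<lambda>w\<in>carrier W. w)}"


section \<open>Representations of the category\<close>

text \<open>
  A functor to left modules over \<open>K\<close> is given by its values \<open>M V\<close> on objects and its values
  \<open>act V W f\<close> on morphisms \<open>f\<close> from \<open>V\<close> to \<open>W\<close>. Source and target are arguments of \<open>act\<close>
  since they are not determined by the underlying function of \<open>f\<close>.
\<close>

locale orI_module =
  fixes R :: "('r, 'c) ring_scheme"
    and K :: "('k, 'd) ring_scheme"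
    and M :: "('r, 'v) orthogonal_module \<Rightarrow> ('k, 'm) module"
    and act :: "('r, 'v) orthogonal_module \<Rightarrow> ('r, 'v) orthogonal_module \<Rightarrow> ('v \<Rightarrow> 'v) \<Rightarrow> 'm \<Rightarrow> 'm"
  assumes left_module: "orthogonal_module R V \<Longrightarrow> left_module K (M V)"
    and linear:
      "\<lbrakk>orthogonal_module R V; orthogonal_module R W; f \<in> isometries R V W\<rbrakk> \<Longrightarrow>
        linear_map K (M V) (M W) (act V W f)"
    and id:
      "\<lbrakk>orthogonal_module R V; x \<in> carrier (M V)\<rbrakk> \<Longrightarrow> act V V (\<lambda>v\<in>carrier V. v) x = x"
    and comp:
      "\<lbrakk>orthogonal_module R U; orthogonal_module R V; orthogonal_module R W;
        f \<in> isometries R U V; g \<in> isometries R V W; x \<in> carrier (M U)\<rbrakk> \<Longrightarrow>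
        act U W (compose (carrier U) g f) x = act V W g (act U V f x)"

definition orI_submodule ::
  "('r, 'c) ring_scheme \<Rightarrow> ('k, 'd) ring_scheme \<Rightarrow>
   (('r, 'v) orthogonal_module \<Rightarrow> ('k, 'm) module) \<Rightarrow>
   (('r, 'v) orthogonal_module \<Rightarrow> ('r, 'v) orthogonal_module \<Rightarrow> ('v \<Rightarrow> 'v) \<Rightarrow> 'm \<Rightarrow> 'm) \<Rightarrow>
   (('r, 'v) orthogonal_module \<Rightarrow> 'm set) \<Rightarrow> bool" where
  "orI_submodule R K M act N \<longleftrightarrow>
     (\<forall>V. orthogonal_module R V \<longrightarrow> submodule (N V) K (M V)) \<and>
     (\<forall>V W. orthogonal_module R V \<longrightarrow> orthogonal_module R W \<longrightarrow>
        (\<forall>f\<in>isometries R V W. act V W f ` N V \<subseteq> N W))"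

definition finitely_generated ::
  "('r, 'c) ring_scheme \<Rightarrow> ('k, 'd) ring_scheme \<Rightarrow>
   (('r, 'v) orthogonal_module \<Rightarrow> ('k, 'm) module) \<Rightarrow>
   (('r, 'v) orthogonal_module \<Rightarrow> ('r, 'v) orthogonal_module \<Rightarrow> ('v \<Rightarrow> 'v) \<Rightarrow> 'm \<Rightarrow> 'm) \<Rightarrow> bool" where
  "finitely_generated R K M act \<longleftrightarrow>
     (\<exists>G. finite G \<and> (\<forall>(V, x)\<in>G. orthogonal_module R V \<and> x \<in> carrier (M V)) \<and>
       (\<forall>N. orI_submodule R K M act N \<and> (\<forall>(V, x)\<in>G. x \<in> N V) \<longrightarrow>
          (\<forall>V. orthogonal_module R V \<longrightarrow> N V = carrier (M V))))"

end

theory Submission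
  imports Defs "HOL-Library.Ramsey"
begin

text \<open>
  If \<open>M\<close> is generated by elements \<open>x\<close> of \<open>M U\<close>, for finitely many \<open>U\<close>, then \<open>M W\<close> is spanned by
  the images of these elements under isometries \<open>h\<close> from \<open>U\<close> to \<open>W\<close>. Given \<open>f\<close> from \<open>V\<close> to \<open>W\<close>,
  it therefore suffices to find an isometry \<open>k\<close> from \<open>U\<close> to \<open>V\<close> and an automorphism \<open>g\<close> of \<open>W\<close>
  with \<open>g f k = h\<close>. If \<open>f k\<close> and \<open>h\<close> have orthogonal images, a reflection exchanges them, so no
  form of Witt's theorem is needed. Such a \<open>k\<close> exists once the rank of \<open>V\<close> is large: by Ramsey's
  theorem a basis of \<open>V\<close> contains a large subset on which all the relevant pairings are
  constant, sums of \<open>card R\<close> elements of this subset span a totally isotropic direct summand,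
  and combining these sums with dual vectors realises every symmetric matrix as a Gram matrix,
  since \<open>2\<close> is invertible.
\<close>

section \<open>A Ramsey argument\<close>

text \<open>Ramsey's theorem for pairs gives a set of \<open>m * card D\<close> elements on which
  \<open>c\<close> is constant off the diagonal; the pigeonhole principle then leaves
  \<open>m\<close> of them on which \<open>d\<close> is constant too. The bound is uniform in
  \<open>B\<close>, \<open>c\<close> and \<open>d\<close>, hence can later serve for all modules at
  once.\<close>

lemma ramsey_family:
  assumes "finite C" "finite D"
  shows "\<exists>N. \<forall>(B :: 'b set) c d. finite B \<longrightarrow> N \<le> card B \<longrightarrow>
    (\<forall>x\<in>B. \<forall>y\<in>B. x \<noteq> y \<longrightarrow> c x y \<in> C \<and> c x y = c y x) \<longrightarrow> d ` B \<subseteq> D \<longrightarrow>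
    (\<exists>H a b. H \<subseteq> B \<and> m \<le> card H \<and> (\<forall>x\<in>H. \<forall>y\<in>H. x \<noteq> y \<longrightarrow> c x y = a) \<and>
       (\<forall>x\<in>H. d x = b))"
proof -
  obtain e :: "_ \<Rightarrow> nat" and q where e: "bij_betw e C {..<q}"
    using finite_imp_inj_to_nat_seg[OF assms(1)] by (metis inj_on_imp_bij_betw lessThan_def)
  \<comment> \<open>The same size is demanded for each of the \<open>q\<close> colours. It is
    \<open>m * card D\<close> so that splitting by the values of \<open>d\<close> still leaves a
    class of size \<open>m\<close>.\<close>
  obtain N :: nat where N: "partn_lst {..<N} (replicate q (m * card D)) 2"
    using ramsey_full by blast
  show ?thesis
  \<comment> \<open>The \<open>1\<close> makes \<open>B\<close> nonempty, so that
    \<open>card D\<close> is positive and can be cancelled at the end.\<close>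
  proof (intro exI[of _ "max 1 N"] allI impI)
    fix B :: "'b set" and c d
    assume B: "finite B" "max 1 N \<le> card B"
      and c: "\<forall>x\<in>B. \<forall>y\<in>B. x \<noteq> y \<longrightarrow> c x y \<in> C \<and> c x y = c y x" and d: "d ` B \<subseteq> D"
    have "card {..<N} \<le> card B" using B by simp
    then obtain s :: "nat \<Rightarrow> 'b" where s: "s ` {..<N} \<subseteq> B" "inj_on s {..<N}"
      using card_le_inj[of "{..<N}" B] B by blast
    \<comment> \<open>Ramsey's theorem colours unordered pairs of numbers, whereas \<open>c\<close>
      takes two arguments. \<open>Min\<close> and \<open>Max\<close> choose an order, and the
      symmetry of \<open>c\<close> makes the choice irrelevant.\<close>
    define g where "g p = e (c (s (Min p)) (s (Max p)))" for p
    have gxy: "g {x, y} = e (c (s x) (s y))" and gq: "g {x, y} < q"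
      if "x < N" "y < N" "x \<noteq> y" for x y
    proof -
      have ne: "s x \<noteq> s y" and sB: "s x \<in> B" "s y \<in> B"
        using that s by (auto simp: inj_on_def)
      show "g {x, y} = e (c (s x) (s y))"
        using c ne sB by (cases "x < y") (auto simp: g_def)
      then show "g {x, y} < q"
        using e c ne sB by (auto simp: bij_betw_def)
    qed
    have "g \<in> nsets {..<N} 2 \<rightarrow> {..<q}"
      using gq by (fastforce simp: nsets_2_eq)
    then obtain i H where iH: "i < q" "H \<in> nsets {..<N} (m * card D)" "g ` nsets H 2 \<subseteq> {i}"
      by (rule partn_lstE[OF N]) auto
    have H: "H \<subseteq> {..<N}" "finite H" "card H = m * card D"
      using iH by (auto simp: nsets_def)
    have cH: "c (s x) (s y) = inv_into C e i" if "x \<in> H" "y \<in> H" "x \<noteq> y" for x y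
    proof -
      have "{x, y} \<in> nsets H 2" using that by simp
      then have "g {x, y} = i" using iH by blast
      then have "e (c (s x) (s y)) = i" using gxy[of x y] that H(1) by (metis lessThan_iff subsetD)
      moreover have "c (s x) (s y) \<in> C"
        using that H s c by (metis image_subset_iff inj_onD subsetD)
      ultimately show ?thesis
        using e by (metis bij_betw_inv_into_left)
    qed
    have "D \<noteq> {}" using d B by auto
    have sH: "s ` H \<subseteq> B" "card (s ` H) = m * card D"
      using s H by (auto simp: card_image inj_on_subset)
    have "\<exists>b\<in>D. card (s ` H) \<le> card (d -` {b} \<inter> s ` H) * card D"
      using d sH H \<open>D \<noteq> {}\<close> assms(2) by (intro pigeonhole_card) auto
    then obtain b where b: "b \<in> D" "m * card D \<le> card (d -` {b} \<inter> s ` H) * card D"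
      using sH by auto
    moreover have "0 < card D" using \<open>D \<noteq> {}\<close> assms(2) by (simp add: card_gt_0_iff)
    ultimately have "m \<le> card (d -` {b} \<inter> s ` H)" by simp
    then show "\<exists>H a b. H \<subseteq> B \<and> m \<le> card H \<and>
        (\<forall>x\<in>H. \<forall>y\<in>H. x \<noteq> y \<longrightarrow> c x y = a) \<and> (\<forall>x\<in>H. d x = b)"
      using sH(1) cH
      by (intro exI[of _ "d -` {b} \<inter> s ` H"] exI[of _ "inv_into C e i"] exI[of _ b]) auto
  qed
qed

section \<open>Linear maps and forms\<close>

lemma linear_map_finsum:
  assumes "module R V" "module R W" "linear_map R V W f" "finite A" "x \<in> A \<rightarrow> carrier V"
  shows "f (\<Oplus>\<^bsub>V\<^esub>a\<in>A. x a) = (\<Oplus>\<^bsub>W\<^esub>a\<in>A. f (x a))"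
proof -
  interpret V: module R V by fact
  interpret W: module R W by fact
  have f: "f \<in> carrier V \<rightarrow> carrier W" using assms by (auto simp: linear_map_def)
  \<comment> \<open>Homogeneity at the scalar zero gives that \<open>f\<close> preserves zero, which
    is the case of the empty sum.\<close>
  have "f (\<zero>\<^bsub>R\<^esub> \<odot>\<^bsub>V\<^esub> \<zero>\<^bsub>V\<^esub>) = \<zero>\<^bsub>R\<^esub> \<odot>\<^bsub>W\<^esub> f \<zero>\<^bsub>V\<^esub>"
    using assms(3) by (auto simp: linear_map_def simp del: V.smult_l_null V.smult_r_null)
  moreover have "f \<zero>\<^bsub>V\<^esub> \<in> carrier W" using f by auto
  ultimately have f0: "f \<zero>\<^bsub>V\<^esub> = \<zero>\<^bsub>W\<^esub>" by simp
  show ?thesis using assms(4,5)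
  proof (induction rule: finite_induct)
    case (insert a A)
    then have "(\<lambda>a. f (x a)) \<in> A \<rightarrow> carrier W" "f (x a) \<in> carrier W" using f by auto
    then show ?case using insert assms(3) by (simp add: linear_map_def V.finsum_closed)
  qed (simp add: f0)
qed

lemma linear_map_lincomb:
  assumes "module R V" "module R W" "linear_map R V W f" "finite A"
    "c \<in> A \<rightarrow> carrier R" "x \<in> A \<rightarrow> carrier V"
  shows "f (\<Oplus>\<^bsub>V\<^esub>a\<in>A. c a \<odot>\<^bsub>V\<^esub> x a) = (\<Oplus>\<^bsub>W\<^esub>a\<in>A. c a \<odot>\<^bsub>W\<^esub> f (x a))"
proof -
  interpret V: module R V by fact
  interpret W: module R W by fact
  have "f (\<Oplus>\<^bsub>V\<^esub>a\<in>A. c a \<odot>\<^bsub>V\<^esub> x a) = (\<Oplus>\<^bsub>W\<^esub>a\<in>A. f (c a \<odot>\<^bsub>V\<^esub> x a))"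
    using assms by (intro linear_map_finsum) auto
  also have "\<dots> = (\<Oplus>\<^bsub>W\<^esub>a\<in>A. c a \<odot>\<^bsub>W\<^esub> f (x a))"
    using assms by (intro W.finsum_cong') (auto simp: linear_map_def Pi_iff)
  finally show ?thesis .
qed

lemma regular_module_simps [simp]:
  "carrier (regular_module R) = carrier R"
  "x \<oplus>\<^bsub>regular_module R\<^esub> y = x \<oplus>\<^bsub>R\<^esub> y"
  "\<zero>\<^bsub>regular_module R\<^esub> = \<zero>\<^bsub>R\<^esub>"
  "x \<odot>\<^bsub>regular_module R\<^esub> y = x \<otimes>\<^bsub>R\<^esub> y"
  "finsum (regular_module R) = finsum R"
  by (simp_all add: regular_module_def finsum_def finprod_def fun_eq_iff)

lemma module_regular_module:
  assumes "cring R"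
  shows "module R (regular_module R)"
proof -
  interpret cring R by fact
  have "\<exists>y\<in>carrier R. y \<oplus>\<^bsub>R\<^esub> x = \<zero>\<^bsub>R\<^esub>" if "x \<in> carrier R" for x
    using that l_neg a_inv_closed by blast
  then show ?thesis
    by (intro moduleI abelian_groupI assms) (simp_all add: l_distr r_distr a_ac m_assoc)
qed

section \<open>Bilinear calculus of the form\<close>

context orthogonal_module
begin

lemma form_closed [simp]: "v \<in> carrier V \<Longrightarrow> w \<in> carrier V \<Longrightarrow> form V v w \<in> carrier R"
  using linear[of v] by (auto simp: linear_map_def)

lemma form_add_right:
  "\<lbrakk>v \<in> carrier V; w \<in> carrier V; w' \<in> carrier V\<rbrakk> \<Longrightarrow>
    form V v (w \<oplus>\<^bsub>V\<^esub> w') = form V v w \<oplus> form V v w'"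
  using linear[of v] by (auto simp: linear_map_def)

lemma form_smult_right:
  "\<lbrakk>v \<in> carrier V; w \<in> carrier V; a \<in> carrier R\<rbrakk> \<Longrightarrow>
    form V v (a \<odot>\<^bsub>V\<^esub> w) = a \<otimes> form V v w"
  using linear[of v] by (auto simp: linear_map_def)

lemma form_add_left:
  "\<lbrakk>v \<in> carrier V; w \<in> carrier V; w' \<in> carrier V\<rbrakk> \<Longrightarrow>
    form V (w \<oplus>\<^bsub>V\<^esub> w') v = form V w v \<oplus> form V w' v"
  by (simp add: symmetric[of _ v] form_add_right)

lemma form_smult_left:
  "\<lbrakk>v \<in> carrier V; w \<in> carrier V; a \<in> carrier R\<rbrakk> \<Longrightarrow>
    form V (a \<odot>\<^bsub>V\<^esub> w) v = a \<otimes> form V w v"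
  by (simp add: symmetric[of _ v] form_smult_right)

lemma form_finsum_right:
  "\<lbrakk>v \<in> carrier V; finite A; x \<in> A \<rightarrow> carrier V\<rbrakk> \<Longrightarrow>
    form V v (\<Oplus>\<^bsub>V\<^esub>a\<in>A. x a) = (\<Oplus>a\<in>A. form V v (x a))"
  using linear_map_finsum[OF _ module_regular_module linear] module_axioms R.is_cring by fastforce

lemma form_finsum_left:
  "\<lbrakk>v \<in> carrier V; finite A; x \<in> A \<rightarrow> carrier V\<rbrakk> \<Longrightarrow>
    form V (\<Oplus>\<^bsub>V\<^esub>a\<in>A. x a) v = (\<Oplus>a\<in>A. form V (x a) v)"
  using form_finsum_right[of v A x] symmetric[of _ v]
  by (subst symmetric) (auto intro!: R.finsum_cong' M.finsum_closed simp: Pi_iff)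

lemma form_minus_right:
  assumes "v \<in> carrier V" "w \<in> carrier V"
  shows "form V v (\<ominus>\<^bsub>V\<^esub> w) = \<ominus> form V v w"
proof -
  have "form V v (\<ominus>\<^bsub>V\<^esub> w) \<oplus> form V v w = form V v (\<zero> \<odot>\<^bsub>V\<^esub> w)"
    using assms by (simp add: form_add_right[symmetric] M.l_neg)
  also have "\<dots> = \<zero>"
    using assms by (simp only: form_smult_right R.zero_closed) simp
  finally show ?thesis
    using assms by (intro R.minus_equality[symmetric]) auto
qed

lemma form_diff_right:
  "\<lbrakk>v \<in> carrier V; w \<in> carrier V; w' \<in> carrier V\<rbrakk> \<Longrightarrow>
    form V v (w \<ominus>\<^bsub>V\<^esub> w') = form V v w \<ominus> form V v w'"
  by (simp add: M.minus_eq R.minus_eq form_add_right form_minus_right)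

lemma form_diff_left:
  "\<lbrakk>v \<in> carrier V; w \<in> carrier V; w' \<in> carrier V\<rbrakk> \<Longrightarrow>
    form V (w \<ominus>\<^bsub>V\<^esub> w') v = form V w v \<ominus> form V w' v"
  by (simp add: symmetric[of _ v] form_diff_right)

lemma form_lincomb_right:
  assumes "v \<in> carrier V" "finite A" "c \<in> A \<rightarrow> carrier R" "x \<in> A \<rightarrow> carrier V"
  shows "form V v (\<Oplus>\<^bsub>V\<^esub>a\<in>A. c a \<odot>\<^bsub>V\<^esub> x a) = (\<Oplus>a\<in>A. c a \<otimes> form V v (x a))"
proof -
  have "form V v (\<Oplus>\<^bsub>V\<^esub>a\<in>A. c a \<odot>\<^bsub>V\<^esub> x a) = (\<Oplus>a\<in>A. form V v (c a \<odot>\<^bsub>V\<^esub> x a))"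
    using assms by (intro form_finsum_right) auto
  also have "\<dots> = (\<Oplus>a\<in>A. c a \<otimes> form V v (x a))"
    using assms by (intro R.finsum_cong') (auto simp: form_smult_right Pi_iff)
  finally show ?thesis .
qed

section \<open>Nondegeneracy, representing vectors and dual bases\<close>

lemma form_inject:
  assumes "v \<in> carrier V" "w \<in> carrier V" "\<And>u. u \<in> carrier V \<Longrightarrow> form V v u = form V w u"
  shows "v = w"
proof -
  have "(\<lambda>u\<in>carrier V. form V v u) = (\<lambda>u\<in>carrier V. form V w u)"
    using assms by (auto simp: restrict_def)
  then show ?thesis
    using nondegenerate assms by (auto simp: bij_betw_def inj_on_def)
qed

text \<open>This is the surjective half of nondegeneracy. It is the source of all vectors that are
  defined by their pairings: dual bases, and values of adjoint maps.\<close>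

lemma form_represents:
  assumes "linear_map R V (regular_module R) \<theta>"
  obtains v where "v \<in> carrier V" "\<And>u. u \<in> carrier V \<Longrightarrow> form V v u = \<theta> u"
proof -
  have "restrict \<theta> (carrier V) \<in> dual_space R V"
    using assms by (auto simp: dual_space_def linear_map_def)
  then obtain v where "v \<in> carrier V"
    "(\<lambda>u\<in>carrier V. form V v u) = restrict \<theta> (carrier V)"
    using nondegenerate unfolding bij_betw_def by (metis (no_types, lifting) imageE)
  then show thesis using that by (metis restrict_apply')
qed

text \<open>Coordinates with respect to \<open>B\<close> are linear functionals, and nondegeneracy
  represents each of them by a vector \<open>d b\<close>.\<close>

lemma dual_basis:
  assumes B: "is_basis R V B"
  obtains d where "d \<in> B \<rightarrow> carrier V"
    "\<And>a b. a \<in> B \<Longrightarrow> b \<in> B \<Longrightarrow> form V (d a) b = (if a = b then \<one> else \<zero>)"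
    "\<And>v. v \<in> carrier V \<Longrightarrow> v = (\<Oplus>\<^bsub>V\<^esub>b\<in>B. form V (d b) v \<odot>\<^bsub>V\<^esub> b)"
proof -
  have fin: "finite B" and sub: "B \<subseteq> carrier V" using B by (auto simp: is_basis_def)
  \<comment> \<open>Uniqueness of the family \<open>c\<close> with \<open>P v c\<close> is what
    proves linearity: sums and multiples of coordinate families satisfy \<open>P\<close> for the
    corresponding vectors, hence are their coordinates.\<close>
  define P where "P v c \<longleftrightarrow> c \<in> B \<rightarrow>\<^sub>E carrier R \<and> v = (\<Oplus>\<^bsub>V\<^esub>b\<in>B. c b \<odot>\<^bsub>V\<^esub> b)" for v c
  have ex1: "\<exists>!c. P v c" if "v \<in> carrier V" for v
    using B that by (simp add: is_basis_def P_def)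
  define co where "co v = (THE c. P v c)" for v
  have co: "P v (co v)" if "v \<in> carrier V" for v
    unfolding co_def by (rule theI'[OF ex1[OF that]])
  have co_sum: "(\<Oplus>\<^bsub>V\<^esub>b\<in>B. co v b \<odot>\<^bsub>V\<^esub> b) = v" if "v \<in> carrier V" for v
    using co[OF that] unfolding P_def by (elim conjE) (rule sym)
  have coI: "co v = c" if "v \<in> carrier V" "P v c" for v c
    using ex1 co that by blast
  have coc: "co v b \<in> carrier R" if "v \<in> carrier V" "b \<in> B" for v b
    using co[OF that(1)] that(2) by (auto simp: P_def)
  have Pc: "(\<lambda>b. co v b \<odot>\<^bsub>V\<^esub> b) \<in> B \<rightarrow> carrier V" if "v \<in> carrier V" for v
    using coc that sub by auto
  have add: "co (v \<oplus>\<^bsub>V\<^esub> w) = (\<lambda>b\<in>B. co v b \<oplus> co w b)" if v: "v \<in> carrier V" "w \<in> carrier V" for v w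
  proof (rule coI)
    have "v \<oplus>\<^bsub>V\<^esub> w = (\<Oplus>\<^bsub>V\<^esub>b\<in>B. co v b \<odot>\<^bsub>V\<^esub> b) \<oplus>\<^bsub>V\<^esub> (\<Oplus>\<^bsub>V\<^esub>b\<in>B. co w b \<odot>\<^bsub>V\<^esub> b)"
      by (simp only: co_sum v)
    also have "\<dots> = (\<Oplus>\<^bsub>V\<^esub>b\<in>B. co v b \<odot>\<^bsub>V\<^esub> b \<oplus>\<^bsub>V\<^esub> co w b \<odot>\<^bsub>V\<^esub> b)"
      using Pc v by (simp add: M.finsum_addf)
    also have "\<dots> = (\<Oplus>\<^bsub>V\<^esub>b\<in>B. (\<lambda>b\<in>B. co v b \<oplus> co w b) b \<odot>\<^bsub>V\<^esub> b)"
      using sub coc v by (intro M.finsum_cong') (auto simp: smult_l_distr)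
    finally show "P (v \<oplus>\<^bsub>V\<^esub> w) (\<lambda>b\<in>B. co v b \<oplus> co w b)"
      using coc v by (auto simp: P_def)
  qed (use v in auto)
  have sm: "co (a \<odot>\<^bsub>V\<^esub> v) = (\<lambda>b\<in>B. a \<otimes> co v b)" if v: "v \<in> carrier V" "a \<in> carrier R" for v a
  proof (rule coI)
    have "a \<odot>\<^bsub>V\<^esub> v = a \<odot>\<^bsub>V\<^esub> (\<Oplus>\<^bsub>V\<^esub>b\<in>B. co v b \<odot>\<^bsub>V\<^esub> b)"
      by (simp only: co_sum v)
    also have "\<dots> = (\<Oplus>\<^bsub>V\<^esub>b\<in>B. a \<odot>\<^bsub>V\<^esub> (co v b \<odot>\<^bsub>V\<^esub> b))"
      using Pc v fin by (simp add: finsum_smult_ldistr)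
    also have "\<dots> = (\<Oplus>\<^bsub>V\<^esub>b\<in>B. (\<lambda>b\<in>B. a \<otimes> co v b) b \<odot>\<^bsub>V\<^esub> b)"
      using sub coc v by (intro M.finsum_cong') (auto simp: smult_assoc1)
    finally show "P (a \<odot>\<^bsub>V\<^esub> v) (\<lambda>b\<in>B. a \<otimes> co v b)"
      using coc v by (auto simp: P_def)
  qed (use v in auto)
  have bas: "co b = (\<lambda>a\<in>B. if b = a then \<one> else \<zero>)" if b: "b \<in> B" for b
  proof (rule coI)
    have "b = (\<Oplus>\<^bsub>V\<^esub>a\<in>B. if b = a then a else \<zero>\<^bsub>V\<^esub>)"
      by (rule M.finsum_singleton[symmetric]) (use b fin sub in auto)
    also have "\<dots> = (\<Oplus>\<^bsub>V\<^esub>a\<in>B. (\<lambda>a\<in>B. if b = a then \<one> else \<zero>) a \<odot>\<^bsub>V\<^esub> a)"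
      using sub by (intro M.finsum_cong') auto
    finally show "P b (\<lambda>a\<in>B. if b = a then \<one> else \<zero>)"
      by (auto simp: P_def)
  qed (use b sub in auto)
  have "\<exists>v\<in>carrier V. \<forall>u\<in>carrier V. form V v u = co u b" if "b \<in> B" for b
  proof -
    have "linear_map R V (regular_module R) (\<lambda>u. co u b)"
      using that coc by (auto simp: linear_map_def add sm)
    then show ?thesis by (metis form_represents)
  qed
  then obtain d where d: "\<And>b. b \<in> B \<Longrightarrow> d b \<in> carrier V"
    "\<And>b u. b \<in> B \<Longrightarrow> u \<in> carrier V \<Longrightarrow> form V (d b) u = co u b"
    by metis
  show thesis
  proof
    show "d \<in> B \<rightarrow> carrier V" using d by auto
    show "form V (d a) b = (if a = b then \<one> else \<zero>)" if "a \<in> B" "b \<in> B" for a b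
      using that d bas sub by auto
    fix v assume v: "v \<in> carrier V"
    have "v = (\<Oplus>\<^bsub>V\<^esub>b\<in>B. co v b \<odot>\<^bsub>V\<^esub> b)" by (simp only: co_sum v)
    also have "\<dots> = (\<Oplus>\<^bsub>V\<^esub>b\<in>B. form V (d b) v \<odot>\<^bsub>V\<^esub> b)"
      using d v coc sub by (intro M.finsum_cong') auto
    finally show "v = (\<Oplus>\<^bsub>V\<^esub>b\<in>B. form V (d b) v \<odot>\<^bsub>V\<^esub> b)" .
  qed
qed

end

section \<open>Vectors with prescribed Gram matrix\<close>

text \<open>By Lagrange's theorem the order of a finite additive group annihilates each of its
  elements.\<close>

lemma (in abelian_group) finsum_card_carrier:
  assumes "finite (carrier G)" "a \<in> carrier G"
  shows "(\<Oplus>k\<in>{..<card (carrier G)}. a) = \<zero>"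
  using add.finprod_const[OF assms(2), of "{..<card (carrier G)}"] add.power_order_eq_one[OF assms]
  by simp

lemma orthogonal_basis_rk:
  assumes "orthogonal_module R V"
  obtains B where "is_basis R V B" "card B = rk R V"
proof -
  interpret orthogonal_module R V by fact
  have "\<exists>B. is_basis R V B \<and> card B = rk R V"
    unfolding rk_def by (rule LeastI_ex) (use free in blast)
  then show thesis using that by blast
qed

text \<open>Produces a totally isotropic family \<open>e\<close> orthogonal to given vectors
  \<open>t\<close>, together with a dual family \<open>f\<close>. The bound depends on
  \<open>R\<close>, \<open>I\<close> and \<open>J\<close> only, not on \<open>V\<close> or
  \<open>t\<close>. Nothing is claimed about the pairings of \<open>f\<close> with itself or with
  \<open>t\<close>.\<close>

lemma isotropic_family:
  fixes R :: "('r, 'c) ring_scheme"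
  assumes "cring R" "finite (carrier R)" "finite I" "finite J"
  shows "\<exists>N. \<forall>(V :: ('r, 'v) orthogonal_module) t.
    orthogonal_module R V \<longrightarrow> t \<in> I \<rightarrow> carrier V \<longrightarrow> N \<le> rk R V \<longrightarrow>
    (\<exists>e\<in>J \<rightarrow> carrier V. \<exists>f\<in>J \<rightarrow> carrier V.
      (\<forall>i\<in>J. \<forall>j\<in>J. form V (f i) (e j) = (if i = j then \<one>\<^bsub>R\<^esub> else \<zero>\<^bsub>R\<^esub>) \<and>
        form V (e i) (e j) = \<zero>\<^bsub>R\<^esub>) \<and>
      (\<forall>l\<in>I. \<forall>j\<in>J. form V (t l) (e j) = \<zero>\<^bsub>R\<^esub>))"
proof -
  define n where "n = card (carrier R)"
  have "finite (carrier R \<times> (I \<rightarrow>\<^sub>E carrier R))"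
    using assms by (simp add: finite_PiE)
  \<comment> \<open>Each \<open>j\<close> in \<open>J\<close> will receive a block of
    \<open>n\<close> basis vectors, hence the size \<open>card J * n\<close>.\<close>
  from ramsey_family[OF assms(2) this, where m = "card J * n"]
  obtain N where N: "\<forall>(B :: 'v set) c d. finite B \<longrightarrow> N \<le> card B \<longrightarrow>
    (\<forall>x\<in>B. \<forall>y\<in>B. x \<noteq> y \<longrightarrow> c x y \<in> carrier R \<and> c x y = c y x) \<longrightarrow>
    d ` B \<subseteq> carrier R \<times> (I \<rightarrow>\<^sub>E carrier R) \<longrightarrow>
    (\<exists>H a b. H \<subseteq> B \<and> card J * n \<le> card H \<and> (\<forall>x\<in>H. \<forall>y\<in>H. x \<noteq> y \<longrightarrow> c x y = a) \<and>
       (\<forall>x\<in>H. d x = b))"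
    ..
  show ?thesis
  proof (intro exI[of _ N] allI impI)
    fix V :: "('r, 'v) orthogonal_module" and t
    assume V: "orthogonal_module R V" and t: "t \<in> I \<rightarrow> carrier V" and rk: "N \<le> rk R V"
    interpret orthogonal_module R V by fact
    have n: "0 < n" using assms(2) R.zero_closed unfolding n_def by (auto simp: card_gt_0_iff)
    have n0: "(\<Oplus>\<^bsub>R\<^esub>k\<in>{..<n}. a) = \<zero>\<^bsub>R\<^esub>" if "a \<in> carrier R" for a
      unfolding n_def using R.finsum_card_carrier that assms(2) by blast
    obtain B where B: "is_basis R V B" "card B = rk R V"
      by (rule orthogonal_basis_rk[OF V])
    have finB: "finite B" and BV: "B \<subseteq> carrier V" using B by (auto simp: is_basis_def)
    obtain d where d: "d \<in> B \<rightarrow> carrier V"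
      "\<And>a b. a \<in> B \<Longrightarrow> b \<in> B \<Longrightarrow> form V (d a) b = (if a = b then \<one>\<^bsub>R\<^esub> else \<zero>\<^bsub>R\<^esub>)"
      using dual_basis[OF B(1)] by metis
    \<comment> \<open>Pairs of basis vectors are coloured by their pairing, single basis vectors by
      their pairing with themselves and with all \<open>t l\<close>.\<close>
    have "\<exists>H a b. H \<subseteq> B \<and> card J * n \<le> card H \<and>
        (\<forall>x\<in>H. \<forall>y\<in>H. x \<noteq> y \<longrightarrow> form V x y = a) \<and>
        (\<forall>x\<in>H. (form V x x, \<lambda>l\<in>I. form V (t l) x) = b)"
      using BV t rk B(2) finB
      by (intro N[rule_format]) (auto simp: subset_iff Pi_iff intro: symmetric)
    then obtain H a b where H: "H \<subseteq> B" "card J * n \<le> card H"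
      and Ha: "\<forall>x\<in>H. \<forall>y\<in>H. x \<noteq> y \<longrightarrow> form V x y = a"
      and Hb: "\<forall>x\<in>H. (form V x x, \<lambda>l\<in>I. form V (t l) x) = b"
      by (elim exE conjE) (rule that)
    note a = Ha[rule_format] and b = Hb[rule_format]
    have b1: "form V x x = fst b" and b2: "(\<lambda>l\<in>I. form V (t l) x) = snd b" if "x \<in> H" for x
      using b[OF that] by force+
    have "finite H" using H finB finite_subset by blast
    moreover have "card (J \<times> {..<n}) \<le> card H" using H by (simp add: card_cartesian_product)
    \<comment> \<open>The injection \<open>s\<close> cuts out disjoint blocks: the
      \<open>j\<close>-th consists of the vectors \<open>s (j, k)\<close> with
      \<open>k < n\<close>.\<close>
    ultimately obtain s where s: "s ` (J \<times> {..<n}) \<subseteq> H" "inj_on s (J \<times> {..<n})"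
      using card_le_inj[of "J \<times> {..<n}" H] assms by auto
    have sH: "s (j, k) \<in> H" and sV: "s (j, k) \<in> carrier V" and sB: "s (j, k) \<in> B"
      if "j \<in> J" "k < n" for j k
      using s that H BV by auto
    have s_eq: "s (i, k) = s (j, k') \<longleftrightarrow> i = j \<and> k = k'"
      if "i \<in> J" "k < n" "j \<in> J" "k' < n" for i j k k'
      using s that by (auto simp: inj_on_def)
    \<comment> \<open>In \<open>R\<close> any element added \<open>n\<close> times gives zero, so summing over blocks of \<open>n\<close> basis
      vectors with constant pairings kills all pairings with \<open>t\<close> and with each other.\<close>
    define e where "e j = (\<Oplus>\<^bsub>V\<^esub>k\<in>{..<n}. s (j, k))" for j
    \<comment> \<open>The dual vector of one member of a block sees exactly one summand of
      \<open>e j\<close> and no summand of the other blocks.\<close>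
    define f where "f j = d (s (j, 0))" for j
    have e: "e \<in> J \<rightarrow> carrier V" unfolding e_def using sV by (auto intro!: M.finsum_closed)
    have f: "f \<in> J \<rightarrow> carrier V" unfolding f_def using sB n d by auto
    have form_e: "form V v (e j) = (\<Oplus>\<^bsub>R\<^esub>k\<in>{..<n}. form V v (s (j, k)))"
      if "v \<in> carrier V" "j \<in> J" for v j
      unfolding e_def using that sV by (intro form_finsum_right) auto
    have fe: "form V (f i) (e j) = (if i = j then \<one>\<^bsub>R\<^esub> else \<zero>\<^bsub>R\<^esub>)" if ij: "i \<in> J" "j \<in> J" for i j
    proof -
      have "form V (f i) (e j) = (\<Oplus>\<^bsub>R\<^esub>k\<in>{..<n}. form V (f i) (s (j, k)))"
        using ij f by (intro form_e) auto
      also have "\<dots> = (\<Oplus>\<^bsub>R\<^esub>k\<in>{..<n}. if 0 = k then (if i = j then \<one>\<^bsub>R\<^esub> else \<zero>\<^bsub>R\<^esub>) else \<zero>\<^bsub>R\<^esub>)"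
        using ij n sB s_eq by (intro R.finsum_cong') (auto simp: f_def d)
      also have "\<dots> = (if i = j then \<one>\<^bsub>R\<^esub> else \<zero>\<^bsub>R\<^esub>)"
        using n by (intro R.finsum_singleton) auto
      finally show ?thesis .
    qed
    have ee: "form V (e i) (e j) = \<zero>\<^bsub>R\<^esub>" if ij: "i \<in> J" "j \<in> J" for i j
    proof -
      \<comment> \<open>The pairing of any vector of block \<open>i\<close> with the whole sum
        \<open>e j\<close>. For different blocks it is \<open>n\<close> times \<open>a\<close>,
        which vanishes; for the same block it is one pairing of a vector with itself plus
        \<open>n - 1\<close> copies of \<open>a\<close>. As it does not depend on \<open>k\<close>,
        summing over block \<open>i\<close> gives \<open>n\<close> times \<open>r\<close>, which is
        zero.\<close>
      define r where "r = (if i = j then fst b \<oplus>\<^bsub>R\<^esub> add_pow R (n - 1) a else \<zero>\<^bsub>R\<^esub>)"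
      have inner: "form V (s (i, k)) (e j) = r" if k: "k < n" for k
      proof -
        have *: "form V (s (i, k)) (e j) = (\<Oplus>\<^bsub>R\<^esub>k'\<in>{..<n}. form V (s (i, k)) (s (j, k')))"
          using ij k sV by (intro form_e) auto
        show ?thesis
        proof (cases "i = j")
          case False
          have eq: "form V (s (i, k)) (s (j, k')) = form V (s (i, k)) (s (j, 0))" if "k' < n" for k'
            using a[OF sH[OF ij(1) k] sH[OF ij(2)]] s_eq[OF ij(1) k ij(2)] False that n by auto
          have "(\<Oplus>\<^bsub>R\<^esub>k'\<in>{..<n}. form V (s (i, k)) (s (j, k'))) =
              (\<Oplus>\<^bsub>R\<^esub>k'\<in>{..<n}. form V (s (i, k)) (s (j, 0)))"
            by (rule R.finsum_cong'[OF refl _ eq]) (use sV ij k n in auto)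
          then show ?thesis using * n0 sV ij k n False by (simp add: r_def)
        next
          case True
          have kn: "{..<n} = insert k ({..<n} - {k})" using k by auto
          have "(\<Oplus>\<^bsub>R\<^esub>k'\<in>{..<n}. form V (s (i, k)) (s (j, k'))) =
            form V (s (i, k)) (s (j, k)) \<oplus>\<^bsub>R\<^esub>
              (\<Oplus>\<^bsub>R\<^esub>k'\<in>{..<n} - {k}. form V (s (i, k)) (s (j, k')))"
            using sV ij k by (subst kn, subst R.finsum_insert) auto
          also have "(\<Oplus>\<^bsub>R\<^esub>k'\<in>{..<n} - {k}. form V (s (i, k)) (s (j, k'))) = add_pow R (n - 1) a"
          \<comment> \<open>Only a pair of distinct vectors shows that \<open>a\<close> lies in
            \<open>R\<close>. For a block of one vector the remaining sum is empty, as is the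
            multiple.\<close>
          proof (cases "{..<n} - {k} = {}")
            case True
            then have "card ({..<n} - {k}) = 0" by simp
            then have "n - 1 = 0" using k by simp
            then show ?thesis unfolding True by simp
          next
            case False
            then obtain k' where k': "k' < n" "k' \<noteq> k" by auto
            have "form V (s (i, k)) (s (j, k')) = a" using a sH s_eq k k' ij by auto
            then have ac: "a \<in> carrier R" using sV ij k k' by auto
            have "(\<Oplus>\<^bsub>R\<^esub>k'\<in>{..<n} - {k}. form V (s (i, k)) (s (j, k'))) =
              (\<Oplus>\<^bsub>R\<^esub>k'\<in>{..<n} - {k}. a)"
              using sV ij k sH s_eq ac a by (intro R.finsum_cong') auto
            also have "\<dots> = add_pow R (n - 1) a"
              using k by (simp add: R.add.finprod_const[OF ac])
            finally show ?thesis .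
          qed
          finally show ?thesis using * b1 sH k ij True by (simp add: r_def)
        qed
      qed
      then have rc: "r \<in> carrier R" using sV e n ij by (metis PiE form_closed)
      have "form V (e i) (e j) = (\<Oplus>\<^bsub>R\<^esub>k\<in>{..<n}. form V (s (i, k)) (e j))"
        unfolding e_def[of i] using e ij sV by (intro form_finsum_left) auto
      also have "\<dots> = (\<Oplus>\<^bsub>R\<^esub>k\<in>{..<n}. r)"
        using inner rc by (intro R.finsum_cong') auto
      finally show ?thesis using n0 rc by simp
    qed
    have te: "form V (t l) (e j) = \<zero>\<^bsub>R\<^esub>" if l: "l \<in> I" and j: "j \<in> J" for l j
    proof -
      have tl: "t l \<in> carrier V" using t l by auto
      have eq: "form V (t l) (s (j, k)) = form V (t l) (s (j, 0))" if "k < n" for k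
        using b2[OF sH[OF j that]] b2[OF sH[OF j n]] l by (metis restrict_apply')
      have "(\<Oplus>\<^bsub>R\<^esub>k\<in>{..<n}. form V (t l) (s (j, k))) = (\<Oplus>\<^bsub>R\<^esub>k\<in>{..<n}. form V (t l) (s (j, 0)))"
        by (rule R.finsum_cong'[OF refl _ eq]) (use sV j n tl in auto)
      also have "\<dots> = \<zero>\<^bsub>R\<^esub>" using sV j n tl by (intro n0) auto
      finally show ?thesis using form_e j tl by auto
    qed
    show "\<exists>e\<in>J \<rightarrow> carrier V. \<exists>f\<in>J \<rightarrow> carrier V.
      (\<forall>i\<in>J. \<forall>j\<in>J. form V (f i) (e j) = (if i = j then \<one>\<^bsub>R\<^esub> else \<zero>\<^bsub>R\<^esub>) \<and>
        form V (e i) (e j) = \<zero>\<^bsub>R\<^esub>) \<and>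
      (\<forall>l\<in>I. \<forall>j\<in>J. form V (t l) (e j) = \<zero>\<^bsub>R\<^esub>)"
      using e f fe ee te by (intro bexI[of _ e] bexI[of _ f]) auto
  qed
qed

text \<open>Take \<open>v i = F i + G i\<close>, where \<open>F\<close> is dual to an isotropic
  family \<open>E\<close>, both are orthogonal to \<open>t\<close>, and \<open>G i\<close> is a
  combination of the \<open>E j\<close>. Then \<open>G\<close> contributes only cross terms, namely
  twice its coefficients, to the Gram matrix. Dividing by \<open>2\<close> therefore corrects the
  Gram matrix of \<open>F\<close> to any symmetric \<open>S\<close>.\<close>

lemma prescribed_gram:
  fixes R :: "('r, 'c) ring_scheme"
  assumes R: "cring R" "finite (carrier R)" and two: "\<one>\<^bsub>R\<^esub> \<oplus>\<^bsub>R\<^esub> \<one>\<^bsub>R\<^esub> \<in> Units R" and I: "finite I"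
  shows "\<exists>N. \<forall>(V :: ('r, 'v) orthogonal_module) t S.
    orthogonal_module R V \<longrightarrow> t \<in> I \<rightarrow> carrier V \<longrightarrow>
    (\<forall>i\<in>I. \<forall>j\<in>I. S i j \<in> carrier R \<and> S i j = S j i) \<longrightarrow> N \<le> rk R V \<longrightarrow>
    (\<exists>v\<in>I \<rightarrow> carrier V. \<forall>i\<in>I. \<forall>j\<in>I. form V (v i) (v j) = S i j \<and> form V (t i) (v j) = \<zero>\<^bsub>R\<^esub>)"
proof -
  \<comment> \<open>For each \<open>i\<close> there are more candidates \<open>f (i, p)\<close> than possible values of the pairings with
    \<open>t\<close>, so some difference of two of them is orthogonal to \<open>t\<close>.\<close>
  define q where "q = card (I \<rightarrow>\<^sub>E carrier R)"
  define J where "J = I \<times> {..q}"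
  have J: "finite J" unfolding J_def using I by simp
  have finE: "finite (I \<rightarrow>\<^sub>E carrier R)" using I R by (simp add: finite_PiE)
  obtain N where N: "\<forall>(V :: ('r, 'v) orthogonal_module) t.
    orthogonal_module R V \<longrightarrow> t \<in> I \<rightarrow> carrier V \<longrightarrow> N \<le> rk R V \<longrightarrow>
    (\<exists>e\<in>J \<rightarrow> carrier V. \<exists>f\<in>J \<rightarrow> carrier V.
      (\<forall>i\<in>J. \<forall>j\<in>J. form V (f i) (e j) = (if i = j then \<one>\<^bsub>R\<^esub> else \<zero>\<^bsub>R\<^esub>) \<and>
        form V (e i) (e j) = \<zero>\<^bsub>R\<^esub>) \<and>
      (\<forall>l\<in>I. \<forall>j\<in>J. form V (t l) (e j) = \<zero>\<^bsub>R\<^esub>))"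
    using isotropic_family[OF R I J] ..
  show ?thesis
  proof (intro exI[of _ N] allI impI)
    fix V :: "('r, 'v) orthogonal_module" and t S
    assume V: "orthogonal_module R V" and t: "t \<in> I \<rightarrow> carrier V" and rk: "N \<le> rk R V"
      and S: "\<forall>i\<in>I. \<forall>j\<in>I. S i j \<in> carrier R \<and> S i j = S j i"
    interpret orthogonal_module R V by fact
    obtain e f where e: "e \<in> J \<rightarrow> carrier V" and f: "f \<in> J \<rightarrow> carrier V"
      and ef: "\<forall>i\<in>J. \<forall>j\<in>J. form V (f i) (e j) = (if i = j then \<one>\<^bsub>R\<^esub> else \<zero>\<^bsub>R\<^esub>) \<and>
        form V (e i) (e j) = \<zero>\<^bsub>R\<^esub>"
      and te: "\<forall>l\<in>I. \<forall>j\<in>J. form V (t l) (e j) = \<zero>\<^bsub>R\<^esub>"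
      using N[rule_format, OF V t rk] by (elim bexE conjE) (rule that)
    have "\<exists>p p'. p \<le> q \<and> p' \<le> q \<and> p \<noteq> p' \<and>
      (\<lambda>l\<in>I. form V (t l) (f (i, p))) = (\<lambda>l\<in>I. form V (t l) (f (i, p')))" if "i \<in> I" for i
    proof -
      let ?h = "\<lambda>p. \<lambda>l\<in>I. form V (t l) (f (i, p))"
      have "?h ` {..q} \<subseteq> I \<rightarrow>\<^sub>E carrier R"
        using t f that by (auto simp: J_def Pi_iff)
      then have "card (?h ` {..q}) \<le> q"
        unfolding q_def using finE by (rule card_mono[rotated])
      \<comment> \<open>The domain \<open>{..q}\<close> has \<open>q + 1\<close> elements, one more
        than the image can have.\<close>
      then have "\<not> inj_on ?h {..q}" by (intro pigeonhole) simp
      then show ?thesis unfolding inj_on_def by blast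
    qed
    then obtain p p' where p: "\<And>i. i \<in> I \<Longrightarrow> p i \<le> q" "\<And>i. i \<in> I \<Longrightarrow> p' i \<le> q"
      "\<And>i. i \<in> I \<Longrightarrow> p i \<noteq> p' i"
      and pp: "\<And>i. i \<in> I \<Longrightarrow>
        (\<lambda>l\<in>I. form V (t l) (f (i, p i))) = (\<lambda>l\<in>I. form V (t l) (f (i, p' i)))"
      by metis
    have pt: "form V (t l) (f (i, p i)) = form V (t l) (f (i, p' i))" if "i \<in> I" "l \<in> I" for i l
      using fun_cong[OF pp[OF that(1)], of l] that(2) by simp
    have pJ: "(i, p i) \<in> J" "(i, p' i) \<in> J" if "i \<in> I" for i
      using p that by (auto simp: J_def)
    \<comment> \<open>Subtracting the two candidates cancels their pairings with \<open>t\<close>.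
      Since \<open>E i\<close> is dual to the first candidate and orthogonal to the second,
      \<open>F i\<close> still pairs to one with \<open>E i\<close>.\<close>
    define E where "E i = e (i, p i)" for i
    define F where "F i = f (i, p i) \<ominus>\<^bsub>V\<^esub> f (i, p' i)" for i
    have E: "E i \<in> carrier V" and F: "F i \<in> carrier V" and tV: "t i \<in> carrier V" if "i \<in> I" for i
      using that pJ e f t by (auto simp: E_def F_def Pi_iff intro!: M.minus_closed)
    have EE: "form V (E i) (E j) = \<zero>\<^bsub>R\<^esub>" if "i \<in> I" "j \<in> I" for i j
      using that pJ ef by (simp add: E_def)
    have tE: "form V (t i) (E j) = \<zero>\<^bsub>R\<^esub>" if "i \<in> I" "j \<in> I" for i j
      using that pJ te by (simp add: E_def)
    have FE: "form V (F i) (E j) = (if i = j then \<one>\<^bsub>R\<^esub> else \<zero>\<^bsub>R\<^esub>)" if ij: "i \<in> I" "j \<in> I" for i j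
    proof -
      have "form V (f (i, p i)) (E j) = (if i = j then \<one>\<^bsub>R\<^esub> else \<zero>\<^bsub>R\<^esub>)"
        "form V (f (i, p' i)) (E j) = \<zero>\<^bsub>R\<^esub>"
        unfolding E_def using ef pJ[OF ij(1)] pJ[OF ij(2)] p(3)[OF ij(1)] by auto
      moreover have "f (i, p i) \<in> carrier V" "f (i, p' i) \<in> carrier V"
        using f pJ[OF ij(1)] by auto
      ultimately show ?thesis
        using E[OF ij(2)] by (simp add: F_def form_diff_left R.minus_eq)
    qed
    have tF: "form V (t i) (F j) = \<zero>\<^bsub>R\<^esub>" if ij: "i \<in> I" "j \<in> I" for i j
    proof -
      have "f (j, p j) \<in> carrier V" "f (j, p' j) \<in> carrier V"
        using f pJ[OF ij(2)] by auto
      then show ?thesis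
        using tV[OF ij(1)] pt[OF ij(2) ij(1)] by (simp add: F_def form_diff_right R.minus_eq R.r_neg)
    qed
    define h where "h = inv\<^bsub>R\<^esub> (\<one>\<^bsub>R\<^esub> \<oplus>\<^bsub>R\<^esub> \<one>\<^bsub>R\<^esub>)"
    have h: "h \<in> carrier R" "(\<one>\<^bsub>R\<^esub> \<oplus>\<^bsub>R\<^esub> \<one>\<^bsub>R\<^esub>) \<otimes>\<^bsub>R\<^esub> h = \<one>\<^bsub>R\<^esub>"
      using two by (auto simp: h_def)
    \<comment> \<open>Half of the defect between the desired and the actual Gram matrix of
      \<open>F\<close>.\<close>
    define c where "c i j = h \<otimes>\<^bsub>R\<^esub> (S i j \<ominus>\<^bsub>R\<^esub> form V (F i) (F j))" for i j
    have c: "c i j \<in> carrier R" and c_sym: "c j i = c i j"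
      and c2: "form V (F i) (F j) \<oplus>\<^bsub>R\<^esub> (c i j \<oplus>\<^bsub>R\<^esub> c i j) = S i j" if ij: "i \<in> I" "j \<in> I" for i j
    proof -
      have s: "S i j \<in> carrier R" "S i j = S j i" using S ij by auto
      note f = F[OF ij(1)] F[OF ij(2)]
      show "c i j \<in> carrier R" unfolding c_def using h s f by simp
      show "c j i = c i j" unfolding c_def using s symmetric[OF f] by simp
      have "c i j \<oplus>\<^bsub>R\<^esub> c i j = ((\<one>\<^bsub>R\<^esub> \<oplus>\<^bsub>R\<^esub> \<one>\<^bsub>R\<^esub>) \<otimes>\<^bsub>R\<^esub> h) \<otimes>\<^bsub>R\<^esub> (S i j \<ominus>\<^bsub>R\<^esub> form V (F i) (F j))"
        unfolding c_def using h(1) s f by (simp add: R.l_distr R.m_assoc)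
      then have "c i j \<oplus>\<^bsub>R\<^esub> c i j = S i j \<ominus>\<^bsub>R\<^esub> form V (F i) (F j)"
        using h s f by simp
      then show "form V (F i) (F j) \<oplus>\<^bsub>R\<^esub> (c i j \<oplus>\<^bsub>R\<^esub> c i j) = S i j"
        using s f by (simp add: R.minus_eq R.a_ac R.r_neg1 R.r_neg R.r_neg2)
    qed
    define G where "G i = (\<Oplus>\<^bsub>V\<^esub>j\<in>I. c i j \<odot>\<^bsub>V\<^esub> E j)" for i
    have G: "G i \<in> carrier V" if "i \<in> I" for i
      unfolding G_def using that c E by (intro M.finsum_closed) auto
    have form_G: "form V w (G i) = (\<Oplus>\<^bsub>R\<^esub>j\<in>I. c i j \<otimes>\<^bsub>R\<^esub> form V w (E j))"
      if "w \<in> carrier V" "i \<in> I" for w i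
      unfolding G_def using that c E I by (intro form_lincomb_right) auto
    have perp_G: "form V w (G i) = \<zero>\<^bsub>R\<^esub>"
      if "w \<in> carrier V" "i \<in> I" "\<And>j. j \<in> I \<Longrightarrow> form V w (E j) = \<zero>\<^bsub>R\<^esub>" for w i
    proof -
      have "form V w (G i) = (\<Oplus>\<^bsub>R\<^esub>j\<in>I. \<zero>\<^bsub>R\<^esub>)"
        unfolding form_G[OF that(1,2)] using that c by (intro R.finsum_cong') auto
      then show ?thesis by simp
    qed
    have EG: "form V (E j) (G i) = \<zero>\<^bsub>R\<^esub>" and tG: "form V (t j) (G i) = \<zero>\<^bsub>R\<^esub>" if "i \<in> I" "j \<in> I" for i j
      using that E tV EE tE by (auto intro!: perp_G)
    have GG: "form V (G j) (G i) = \<zero>\<^bsub>R\<^esub>" if "i \<in> I" "j \<in> I" for i j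
      using that E G EG symmetric by (intro perp_G) metis+
    have FG: "form V (F j) (G i) = c i j" if ij: "i \<in> I" "j \<in> I" for i j
    proof -
      have "form V (F j) (G i) = (\<Oplus>\<^bsub>R\<^esub>k\<in>I. if j = k then c i k else \<zero>\<^bsub>R\<^esub>)"
        unfolding form_G[OF F[OF ij(2)] ij(1)]
        using ij c FE by (intro R.finsum_cong') auto
      also have "\<dots> = c i j" using ij c I by (intro R.finsum_singleton) auto
      finally show ?thesis .
    qed
    define v where "v i = F i \<oplus>\<^bsub>V\<^esub> G i" for i
    have v: "v \<in> I \<rightarrow> carrier V" using F G by (auto simp: v_def)
    have "form V (v i) (v j) = S i j" if ij: "i \<in> I" "j \<in> I" for i j
    proof -
      have "form V (v i) (v j) = form V (F i) (F j) \<oplus>\<^bsub>R\<^esub> (form V (G i) (F j) \<oplus>\<^bsub>R\<^esub> form V (F i) (G j))"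
        unfolding v_def using ij F G GG
        by (simp add: form_add_left form_add_right R.a_ac)
      also have "form V (G i) (F j) = c i j"
        using FG[OF ij] symmetric[OF G F] ij by simp
      also have "form V (F i) (G j) = c i j"
        using FG[OF ij(2,1)] c_sym[OF ij] by simp
      also have "form V (F i) (F j) \<oplus>\<^bsub>R\<^esub> (c i j \<oplus>\<^bsub>R\<^esub> c i j) = S i j" by (rule c2[OF ij])
      finally show ?thesis .
    qed
    moreover have "form V (t i) (v j) = \<zero>\<^bsub>R\<^esub>" if "i \<in> I" "j \<in> I" for i j
      unfolding v_def using that tV F G tF tG by (simp add: form_add_right)
    ultimately show "\<exists>v\<in>I \<rightarrow> carrier V. \<forall>i\<in>I. \<forall>j\<in>I.
        form V (v i) (v j) = S i j \<and> form V (t i) (v j) = \<zero>\<^bsub>R\<^esub>"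
      using v by blast
  qed
qed

section \<open>Orthogonal copies and reflections\<close>

lemma isometriesD:
  assumes "f \<in> isometries R V W"
  shows "linear_map R V W f"
    and "\<And>x. x \<in> carrier V \<Longrightarrow> f x \<in> carrier W"
    and "\<And>x y. x \<in> carrier V \<Longrightarrow> y \<in> carrier V \<Longrightarrow> f (x \<oplus>\<^bsub>V\<^esub> y) = f x \<oplus>\<^bsub>W\<^esub> f y"
    and "\<And>a x. a \<in> carrier R \<Longrightarrow> x \<in> carrier V \<Longrightarrow> f (a \<odot>\<^bsub>V\<^esub> x) = a \<odot>\<^bsub>W\<^esub> f x"
    and "\<And>x y. x \<in> carrier V \<Longrightarrow> y \<in> carrier V \<Longrightarrow> form W (f x) (f y) = form V x y"
  using assms by (auto simp: isometries_def linear_map_def)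

text \<open>An isometry out of \<open>U\<close> is determined by vectors whose Gram matrix is that
  of a basis of \<open>U\<close>. Orthogonality to the image of \<open>h\<close> in \<open>W\<close>
  becomes orthogonality in \<open>V\<close> to finitely many vectors, the images of the
  \<open>h b\<close> under the adjoint of \<open>f\<close>. The number of these vectors depends on
  \<open>U\<close> only, hence so does the bound.\<close>

lemma orthogonal_copy:
  fixes R :: "('r, 'c) ring_scheme" and U :: "('r, 'v) orthogonal_module"
  assumes R: "cring R" "finite (carrier R)" "\<one>\<^bsub>R\<^esub> \<oplus>\<^bsub>R\<^esub> \<one>\<^bsub>R\<^esub> \<in> Units R" and U: "orthogonal_module R U"
  shows "\<exists>N. \<forall>(V :: ('r, 'v) orthogonal_module) (W :: ('r, 'v) orthogonal_module) f h.
    orthogonal_module R V \<longrightarrow> orthogonal_module R W \<longrightarrow> f \<in> isometries R V W \<longrightarrow>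
    h \<in> isometries R U W \<longrightarrow> N \<le> rk R V \<longrightarrow>
    (\<exists>k\<in>isometries R U V. \<forall>u\<in>carrier U. \<forall>u'\<in>carrier U. form W (h u) (f (k u')) = \<zero>\<^bsub>R\<^esub>)"
proof -
  interpret U: orthogonal_module R U by fact
  obtain B where B: "is_basis R U B" using U.free by blast
  then have fin: "finite B" and BU: "B \<subseteq> carrier U" by (auto simp: is_basis_def)
  obtain d where d: "d \<in> B \<rightarrow> carrier U"
    and "\<And>a b. a \<in> B \<Longrightarrow> b \<in> B \<Longrightarrow> form U (d a) b = (if a = b then \<one>\<^bsub>R\<^esub> else \<zero>\<^bsub>R\<^esub>)"
    and expand: "\<And>u. u \<in> carrier U \<Longrightarrow> u = (\<Oplus>\<^bsub>U\<^esub>b\<in>B. form U (d b) u \<odot>\<^bsub>U\<^esub> b)"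
    by (rule U.dual_basis[OF B]) (rule that)
  define co where "co b u = form U (d b) u" for b u
  have co: "co b u \<in> carrier R" if "b \<in> B" "u \<in> carrier U" for b u
    using that d by (auto simp: co_def Pi_iff)
  have co_sum: "(\<Oplus>\<^bsub>U\<^esub>b\<in>B. co b u \<odot>\<^bsub>U\<^esub> b) = u" if "u \<in> carrier U" for u
    unfolding co_def using expand[OF that] by (rule sym)
  obtain N where N: "\<forall>(V :: ('r, 'v) orthogonal_module) t S.
    orthogonal_module R V \<longrightarrow> t \<in> B \<rightarrow> carrier V \<longrightarrow>
    (\<forall>i\<in>B. \<forall>j\<in>B. S i j \<in> carrier R \<and> S i j = S j i) \<longrightarrow> N \<le> rk R V \<longrightarrow>
    (\<exists>v\<in>B \<rightarrow> carrier V. \<forall>i\<in>B. \<forall>j\<in>B. form V (v i) (v j) = S i j \<and> form V (t i) (v j) = \<zero>\<^bsub>R\<^esub>)"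
    using prescribed_gram[OF R fin] ..
  show ?thesis
  proof (intro exI[of _ N] allI impI)
    fix V W :: "('r, 'v) orthogonal_module" and f h
    assume V: "orthogonal_module R V" and W: "orthogonal_module R W"
      and f: "f \<in> isometries R V W" and h: "h \<in> isometries R U W" and rk: "N \<le> rk R V"
    interpret V: orthogonal_module R V by fact
    interpret W: orthogonal_module R W by fact
    note f' = isometriesD[OF f] and h' = isometriesD[OF h]
    \<comment> \<open>The vector \<open>t b\<close> is the value at \<open>h b\<close> of the
      adjoint of \<open>f\<close>.\<close>
    have "\<exists>t\<in>carrier V. \<forall>v\<in>carrier V. form V t v = form W (h b) (f v)" if b: "b \<in> B" for b
    proof -
      have hb: "h b \<in> carrier W" using BU b h' by auto
      have "linear_map R V (regular_module R) (\<lambda>v. form W (h b) (f v))"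
        using hb f' by (auto simp: linear_map_def W.form_add_right W.form_smult_right)
      then show ?thesis by (rule V.form_represents) blast
    qed
    then obtain t where t: "\<And>b. b \<in> B \<Longrightarrow> t b \<in> carrier V"
      "\<And>b v. b \<in> B \<Longrightarrow> v \<in> carrier V \<Longrightarrow> form V (t b) v = form W (h b) (f v)"
      by metis
    have "t \<in> B \<rightarrow> carrier V" using t by auto
    moreover have "\<forall>i\<in>B. \<forall>j\<in>B. form U i j \<in> carrier R \<and> form U i j = form U j i"
      using BU by (auto simp: subset_iff intro: U.symmetric)
    ultimately obtain v where v: "v \<in> B \<rightarrow> carrier V"
      and gram: "\<forall>i\<in>B. \<forall>j\<in>B. form V (v i) (v j) = form U i j \<and> form V (t i) (v j) = \<zero>\<^bsub>R\<^esub>"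
      using N[rule_format, OF V _ _ rk, of t "form U"] by blast
    \<comment> \<open>The linear extension of the assignment of \<open>v b\<close> to
      \<open>b\<close>; restricted to the carrier because isometries are extensional.\<close>
    define k where "k = (\<lambda>u\<in>carrier U. \<Oplus>\<^bsub>V\<^esub>b\<in>B. co b u \<odot>\<^bsub>V\<^esub> v b)"
    have k: "k u = (\<Oplus>\<^bsub>V\<^esub>b\<in>B. co b u \<odot>\<^bsub>V\<^esub> v b)" if "u \<in> carrier U" for u
      using that by (simp add: k_def)
    have kV: "k u \<in> carrier V" if "u \<in> carrier U" for u
      unfolding k[OF that] using that co v by (intro V.finsum_closed) auto
    have "k (x \<oplus>\<^bsub>U\<^esub> y) = k x \<oplus>\<^bsub>V\<^esub> k y" if xy: "x \<in> carrier U" "y \<in> carrier U" for x y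
    proof -
      have "k (x \<oplus>\<^bsub>U\<^esub> y) = (\<Oplus>\<^bsub>V\<^esub>b\<in>B. co b (x \<oplus>\<^bsub>U\<^esub> y) \<odot>\<^bsub>V\<^esub> v b)" using xy by (intro k) simp
      also have "\<dots> = (\<Oplus>\<^bsub>V\<^esub>b\<in>B. co b x \<odot>\<^bsub>V\<^esub> v b \<oplus>\<^bsub>V\<^esub> co b y \<odot>\<^bsub>V\<^esub> v b)"
      proof (rule V.finsum_cong'[OF refl])
        fix b assume b: "b \<in> B"
        then have "d b \<in> carrier U" "v b \<in> carrier V" using d v by auto
        then show "co b (x \<oplus>\<^bsub>U\<^esub> y) \<odot>\<^bsub>V\<^esub> v b = co b x \<odot>\<^bsub>V\<^esub> v b \<oplus>\<^bsub>V\<^esub> co b y \<odot>\<^bsub>V\<^esub> v b"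
          using xy by (simp add: co_def U.form_add_right V.smult_l_distr)
      qed (use co xy v in \<open>auto simp: Pi_iff\<close>)
      also have "\<dots> = k x \<oplus>\<^bsub>V\<^esub> k y"
        unfolding k[OF xy(1)] k[OF xy(2)] using co xy v by (intro V.finsum_addf) auto
      finally show ?thesis .
    qed
    moreover have "k (a \<odot>\<^bsub>U\<^esub> x) = a \<odot>\<^bsub>V\<^esub> k x" if a: "a \<in> carrier R" and x: "x \<in> carrier U" for a x
    proof -
      have "k (a \<odot>\<^bsub>U\<^esub> x) = (\<Oplus>\<^bsub>V\<^esub>b\<in>B. co b (a \<odot>\<^bsub>U\<^esub> x) \<odot>\<^bsub>V\<^esub> v b)" using a x by (intro k) simp
      also have "\<dots> = (\<Oplus>\<^bsub>V\<^esub>b\<in>B. a \<odot>\<^bsub>V\<^esub> (co b x \<odot>\<^bsub>V\<^esub> v b))"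
      proof (rule V.finsum_cong'[OF refl])
        fix b assume b: "b \<in> B"
        then have "d b \<in> carrier U" "v b \<in> carrier V" using d v by auto
        then show "co b (a \<odot>\<^bsub>U\<^esub> x) \<odot>\<^bsub>V\<^esub> v b = a \<odot>\<^bsub>V\<^esub> (co b x \<odot>\<^bsub>V\<^esub> v b)"
          using a x by (simp add: co_def U.form_smult_right V.smult_assoc1)
      qed (use co a x v in \<open>auto simp: Pi_iff\<close>)
      also have "\<dots> = a \<odot>\<^bsub>V\<^esub> k x"
        unfolding k[OF x] using co x v a fin by (intro V.finsum_smult_ldistr[symmetric]) auto
      finally show ?thesis .
    qed
    ultimately have k_lin: "linear_map R U V k" using kV by (auto simp: linear_map_def)
    have vk: "form V w (k u) = (\<Oplus>\<^bsub>R\<^esub>b\<in>B. co b u \<otimes>\<^bsub>R\<^esub> form V w (v b))"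
      if "w \<in> carrier V" "u \<in> carrier U" for w u
      unfolding k[OF that(2)] using that co v fin by (intro V.form_lincomb_right) auto
    have form_co: "form U w u = (\<Oplus>\<^bsub>R\<^esub>b\<in>B. co b u \<otimes>\<^bsub>R\<^esub> form U w b)"
      if "w \<in> carrier U" "u \<in> carrier U" for w u
    proof -
      have "form U w u = form U w (\<Oplus>\<^bsub>U\<^esub>b\<in>B. co b u \<odot>\<^bsub>U\<^esub> b)" by (simp only: co_sum that)
      also have "\<dots> = (\<Oplus>\<^bsub>R\<^esub>b\<in>B. co b u \<otimes>\<^bsub>R\<^esub> form U w b)"
        using that co BU fin by (intro U.form_lincomb_right) auto
      finally show ?thesis .
    qed
    \<comment> \<open>The isometry property is extended from basis vectors one argument at a time,
      first here and then in the second argument.\<close>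
    have kv: "form V (k u) (v b) = form U u b" if u: "u \<in> carrier U" and b: "b \<in> B" for u b
    proof -
      have vb: "v b \<in> carrier V" and bU: "b \<in> carrier U" using b v BU by auto
      have "form V (k u) (v b) = form V (v b) (k u)" using V.symmetric kV u vb by simp
      also have "\<dots> = (\<Oplus>\<^bsub>R\<^esub>b'\<in>B. co b' u \<otimes>\<^bsub>R\<^esub> form V (v b) (v b'))" by (rule vk[OF vb u])
      also have "\<dots> = (\<Oplus>\<^bsub>R\<^esub>b'\<in>B. co b' u \<otimes>\<^bsub>R\<^esub> form U b b')"
        using gram b co u BU bU by (intro U.R.finsum_cong') auto
      also have "\<dots> = form U b u" by (rule form_co[symmetric, OF bU u])
      also have "\<dots> = form U u b" by (rule U.symmetric[OF bU u])
      finally show ?thesis .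
    qed
    have "form V (k u) (k u') = form U u u'" if u: "u \<in> carrier U" "u' \<in> carrier U" for u u'
    proof -
      have "form V (k u) (k u') = (\<Oplus>\<^bsub>R\<^esub>b\<in>B. co b u' \<otimes>\<^bsub>R\<^esub> form V (k u) (v b))"
        by (rule vk[OF kV[OF u(1)] u(2)])
      also have "\<dots> = (\<Oplus>\<^bsub>R\<^esub>b\<in>B. co b u' \<otimes>\<^bsub>R\<^esub> form U u b)"
        using kv u co BU by (intro U.R.finsum_cong') auto
      also have "\<dots> = form U u u'" by (rule form_co[symmetric, OF u])
      finally show ?thesis .
    qed
    then have k_iso: "k \<in> isometries R U V"
      using k_lin by (auto simp: isometries_def k_def)
    have hk: "form W (h b) (f (k u)) = \<zero>\<^bsub>R\<^esub>" if b: "b \<in> B" and u: "u \<in> carrier U" for b u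
    proof -
      have "form W (h b) (f (k u)) = form V (t b) (k u)" using t b kV[OF u] by simp
      also have "\<dots> = (\<Oplus>\<^bsub>R\<^esub>b'\<in>B. co b' u \<otimes>\<^bsub>R\<^esub> form V (t b) (v b'))" by (rule vk[OF t(1)[OF b] u])
      also have "\<dots> = (\<Oplus>\<^bsub>R\<^esub>b'\<in>B. \<zero>\<^bsub>R\<^esub>)"
        using gram b co u by (intro U.R.finsum_cong') auto
      finally show ?thesis by simp
    qed
    have "form W (h u) (f (k u')) = \<zero>\<^bsub>R\<^esub>" if u: "u \<in> carrier U" "u' \<in> carrier U" for u u'
    proof -
      have fk: "f (k u') \<in> carrier W" and hu: "h u \<in> carrier W" using f' h' kV u by auto
      have "h u = h (\<Oplus>\<^bsub>U\<^esub>b\<in>B. co b u \<odot>\<^bsub>U\<^esub> b)" by (simp only: co_sum u)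
      also have "\<dots> = (\<Oplus>\<^bsub>W\<^esub>b\<in>B. co b u \<odot>\<^bsub>W\<^esub> h b)"
        using U.module_axioms W.module_axioms h'(1) fin co u BU by (intro linear_map_lincomb) auto
      finally have hsum: "h u = (\<Oplus>\<^bsub>W\<^esub>b\<in>B. co b u \<odot>\<^bsub>W\<^esub> h b)" .
      have "form W (h u) (f (k u')) = form W (f (k u')) (h u)" by (rule W.symmetric[OF hu fk])
      also have "\<dots> = (\<Oplus>\<^bsub>R\<^esub>b\<in>B. co b u \<otimes>\<^bsub>R\<^esub> form W (f (k u')) (h b))"
        unfolding hsum using fk fin co u BU h' by (intro W.form_lincomb_right) auto
      also have "\<dots> = (\<Oplus>\<^bsub>R\<^esub>b\<in>B. \<zero>\<^bsub>R\<^esub>)"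
      proof (rule U.R.finsum_cong'[OF refl])
        fix b assume b: "b \<in> B"
        then have "form W (f (k u')) (h b) = \<zero>\<^bsub>R\<^esub>"
          using W.symmetric[OF fk, of "h b"] hk[OF b u(2)] h' BU by auto
        then show "co b u \<otimes>\<^bsub>R\<^esub> form W (f (k u')) (h b) = \<zero>\<^bsub>R\<^esub>" using co b u by simp
      qed auto
      finally show ?thesis by simp
    qed
    with k_iso show "\<exists>k\<in>isometries R U V. \<forall>u\<in>carrier U. \<forall>u'\<in>carrier U.
        form W (h u) (f (k u')) = \<zero>\<^bsub>R\<^esub>"
      by blast
  qed
qed

text \<open>Orthogonality of the images makes \<open>\<delta> = h - y\<close> double the form, so
  its adjoint \<open>D\<close> satisfies \<open>D \<delta> = 2\<close>. Hence
  \<open>1 - \<delta> D\<close> is an isometry and its own inverse. As \<open>D y = -1\<close>, it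
  sends \<open>y u\<close> to \<open>y u + \<delta> u = h u\<close>.\<close>

lemma automorphism_swapping_orthogonal_copies:
  fixes R :: "('r, 'c) ring_scheme" and U W :: "('r, 'v) orthogonal_module"
  assumes U: "orthogonal_module R U" and W: "orthogonal_module R W"
    and h: "h \<in> isometries R U W" and y: "y \<in> isometries R U W"
    and perp: "\<And>u u'. u \<in> carrier U \<Longrightarrow> u' \<in> carrier U \<Longrightarrow> form W (h u) (y u') = \<zero>\<^bsub>R\<^esub>"
  obtains g where "g \<in> automorphisms R W" "\<And>u. u \<in> carrier U \<Longrightarrow> g (y u) = h u"
proof -
  interpret U: orthogonal_module R U by fact
  interpret W: orthogonal_module R W by fact
  note h' = isometriesD[OF h] and y' = isometriesD[OF y]
  have perp': "form W (y u') (h u) = \<zero>\<^bsub>R\<^esub>" if "u \<in> carrier U" "u' \<in> carrier U" for u u'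
    using perp[OF that] W.symmetric h'(2) y'(2) that by metis
  \<comment> \<open>The automorphism is the reflection \<open>1 - \<delta> D\<close>, where \<open>D\<close> is the adjoint of \<open>\<delta>\<close> and \<open>D \<delta> = 2\<close>.\<close>
  define \<delta> where "\<delta> u = h u \<ominus>\<^bsub>W\<^esub> y u" for u
  have \<delta>_closed: "\<delta> u \<in> carrier W" if "u \<in> carrier U" for u
    using that h' y' by (simp add: \<delta>_def)
  have \<delta>_add: "\<delta> (u \<oplus>\<^bsub>U\<^esub> u') = \<delta> u \<oplus>\<^bsub>W\<^esub> \<delta> u'" if "u \<in> carrier U" "u' \<in> carrier U" for u u'
    using that h' y' by (simp add: \<delta>_def W.M.minus_eq W.M.minus_add W.M.a_ac)
  have \<delta>_smult: "\<delta> (a \<odot>\<^bsub>U\<^esub> u) = a \<odot>\<^bsub>W\<^esub> \<delta> u" if "a \<in> carrier R" "u \<in> carrier U" for a u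
    using that h' y' by (simp add: \<delta>_def W.M.minus_eq W.smult_r_distr W.smult_r_minus)
  have \<delta>_minus: "\<delta> (\<ominus>\<^bsub>U\<^esub> u) = \<ominus>\<^bsub>W\<^esub> \<delta> u" if "u \<in> carrier U" for u
  proof -
    have "\<delta> (\<ominus>\<^bsub>U\<^esub> u) = \<delta> ((\<ominus>\<^bsub>R\<^esub> \<one>\<^bsub>R\<^esub>) \<odot>\<^bsub>U\<^esub> u)" using that by (simp add: U.smult_l_minus)
    also have "\<dots> = (\<ominus>\<^bsub>R\<^esub> \<one>\<^bsub>R\<^esub>) \<odot>\<^bsub>W\<^esub> \<delta> u" using that by (intro \<delta>_smult) auto
    also have "\<dots> = \<ominus>\<^bsub>W\<^esub> \<delta> u" using \<delta>_closed[OF that] by (simp add: W.smult_l_minus)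
    finally show ?thesis .
  qed
  have h\<delta>: "form W (h u) (\<delta> u') = form U u u'" and y\<delta>: "form W (y u) (\<delta> u') = \<ominus>\<^bsub>R\<^esub> form U u u'"
    if "u \<in> carrier U" "u' \<in> carrier U" for u u'
    using that h' y' perp perp' by (simp_all add: \<delta>_def W.form_diff_right U.R.minus_eq)
  have \<delta>\<delta>: "form W (\<delta> u) (\<delta> u') = form U u u' \<oplus>\<^bsub>R\<^esub> form U u u'"
    if "u \<in> carrier U" "u' \<in> carrier U" for u u'
  proof -
    have "form W (\<delta> u) (\<delta> u') = form W (h u) (\<delta> u') \<ominus>\<^bsub>R\<^esub> form W (y u) (\<delta> u')"
      unfolding \<delta>_def[of u] using that \<delta>_closed h' y' by (intro W.form_diff_left) auto
    then show ?thesis using that by (simp add: h\<delta> y\<delta> U.R.minus_eq)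
  qed
  \<comment> \<open>Nondegeneracy of \<open>U\<close> provides the adjoint; its linearity follows
    because vectors of \<open>U\<close> are determined by their pairings.\<close>
  have "\<exists>z\<in>carrier U. \<forall>u\<in>carrier U. form U z u = form W w (\<delta> u)" if "w \<in> carrier W" for w
  proof -
    have "linear_map R U (regular_module R) (\<lambda>u. form W w (\<delta> u))"
      using that \<delta>_closed
      by (auto simp: linear_map_def \<delta>_add \<delta>_smult W.form_add_right W.form_smult_right)
    then show ?thesis by (rule U.form_represents) blast
  qed
  then obtain D where D: "\<And>w. w \<in> carrier W \<Longrightarrow> D w \<in> carrier U"
    and form_D: "\<And>w u. w \<in> carrier W \<Longrightarrow> u \<in> carrier U \<Longrightarrow> form U (D w) u = form W w (\<delta> u)"
    by metis
  have D_add: "D (w \<oplus>\<^bsub>W\<^esub> w') = D w \<oplus>\<^bsub>U\<^esub> D w'" if "w \<in> carrier W" "w' \<in> carrier W" for w w'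
    using that D \<delta>_closed
    by (intro U.form_inject) (simp_all add: form_D U.form_add_left W.form_add_left)
  have D_smult: "D (a \<odot>\<^bsub>W\<^esub> w) = a \<odot>\<^bsub>U\<^esub> D w" if "a \<in> carrier R" "w \<in> carrier W" for a w
    using that D \<delta>_closed
    by (intro U.form_inject) (simp_all add: form_D U.form_smult_left W.form_smult_left)
  have D_y: "D (y u) = \<ominus>\<^bsub>U\<^esub> u" if "u \<in> carrier U" for u
  proof (rule U.form_inject)
    fix u' assume u': "u' \<in> carrier U"
    have "form U (\<ominus>\<^bsub>U\<^esub> u) u' = form U u' (\<ominus>\<^bsub>U\<^esub> u)" using that u' by (intro U.symmetric) auto
    also have "\<dots> = \<ominus>\<^bsub>R\<^esub> form U u u'" using that u' U.symmetric by (simp add: U.form_minus_right)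
    finally show "form U (D (y u)) u' = form U (\<ominus>\<^bsub>U\<^esub> u) u'"
      using that u' y' by (simp add: form_D y\<delta>)
  qed (use that D y' in auto)
  have D_\<delta>: "D (\<delta> u) = u \<oplus>\<^bsub>U\<^esub> u" if "u \<in> carrier U" for u
    using that D \<delta>_closed
    by (intro U.form_inject) (simp_all add: form_D U.form_add_left \<delta>\<delta>)
  \<comment> \<open>Written as a sum rather than a difference so that additivity of \<open>D\<close>
    applies directly when \<open>D (g w)\<close> is computed.\<close>
  define g where "g = (\<lambda>w\<in>carrier W. w \<oplus>\<^bsub>W\<^esub> \<delta> (\<ominus>\<^bsub>U\<^esub> D w))"
  have g: "g w = w \<ominus>\<^bsub>W\<^esub> \<delta> (D w)" if "w \<in> carrier W" for w
    using that D by (simp add: g_def \<delta>_minus W.M.minus_eq)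
  have g_closed: "g w \<in> carrier W" if "w \<in> carrier W" for w
    using that D \<delta>_closed by (simp add: g)
  have "g (w \<oplus>\<^bsub>W\<^esub> w') = g w \<oplus>\<^bsub>W\<^esub> g w'" if "w \<in> carrier W" "w' \<in> carrier W" for w w'
    using that D \<delta>_closed
    by (simp add: g D_add \<delta>_add W.M.minus_eq W.M.minus_add W.M.a_ac)
  moreover have "g (a \<odot>\<^bsub>W\<^esub> w) = a \<odot>\<^bsub>W\<^esub> g w" if "a \<in> carrier R" "w \<in> carrier W" for a w
    using that D \<delta>_closed
    by (simp add: g D_smult \<delta>_smult W.M.minus_eq W.smult_r_distr W.smult_r_minus)
  ultimately have g_lin: "linear_map R W W g"
    using g_closed by (auto simp: linear_map_def)
  have g_form: "form W (g w) (g w') = form W w w'" if w: "w \<in> carrier W" "w' \<in> carrier W" for w w'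
  proof -
    let ?a = "form W w w'" and ?b = "form U (D w) (D w')"
    have c: "?a \<in> carrier R" "?b \<in> carrier R" "D w \<in> carrier U" "D w' \<in> carrier U"
      "\<delta> (D w) \<in> carrier W" "\<delta> (D w') \<in> carrier W"
      using w D \<delta>_closed by auto
    have 1: "form W w (\<delta> (D w')) = ?b" using form_D w c by simp
    have 2: "form W (\<delta> (D w)) w' = ?b"
      using form_D[OF w(2) c(3)] W.symmetric[OF c(5) w(2)] U.symmetric[OF c(3,4)] by simp
    \<comment> \<open>Each cross term contributes \<open>- ?b\<close> and the term quadratic in
      \<open>\<delta>\<close> contributes \<open>?b + ?b\<close>, so all of them cancel.\<close>
    have "form W (g w) (g w') = (?a \<ominus>\<^bsub>R\<^esub> ?b) \<ominus>\<^bsub>R\<^esub> (?b \<ominus>\<^bsub>R\<^esub> (?b \<oplus>\<^bsub>R\<^esub> ?b))"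
      using w c by (simp add: g W.form_diff_left W.form_diff_right 1 2 \<delta>\<delta>)
    also have "\<dots> = ?a"
      using c(1,2) by (simp add: U.R.minus_eq U.R.minus_add U.R.a_ac U.R.r_neg U.R.r_neg1 U.R.r_neg2)
    finally show ?thesis .
  qed
  have g_iso: "g \<in> isometries R W W"
    using g_lin g_form by (auto simp: isometries_def g_def)
  \<comment> \<open>Since \<open>D (g w) = - D w\<close>, the second application of \<open>g\<close>
    adds back the vector \<open>\<delta> (D w)\<close> that the first one subtracted.\<close>
  have gg: "g (g w) = w" if w: "w \<in> carrier W" for w
  proof -
    have c: "D w \<in> carrier U" "\<delta> (D w) \<in> carrier W" using w D \<delta>_closed by auto
    have "D (g w) = D w \<oplus>\<^bsub>U\<^esub> D (\<delta> (\<ominus>\<^bsub>U\<^esub> D w))"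
      using w c \<delta>_closed by (simp add: g_def D_add)
    also have "\<dots> = \<ominus>\<^bsub>U\<^esub> D w"
      using c by (simp add: D_\<delta> U.M.r_neg1 U.M.r_neg2 U.M.a_assoc[symmetric] U.M.r_neg)
    finally have "\<delta> (D (g w)) = \<ominus>\<^bsub>W\<^esub> \<delta> (D w)" using c by (simp add: \<delta>_minus)
    then show ?thesis
      using w c g_closed[OF w] by (simp add: g W.M.minus_eq W.M.a_assoc W.M.l_neg)
  qed
  have "compose (carrier W) g g = (\<lambda>w\<in>carrier W. w)"
    using gg by (auto simp: compose_def restrict_def)
  then have "g \<in> automorphisms R W"
    using g_iso by (auto simp: automorphisms_def)
  moreover have "g (y u) = h u" if u: "u \<in> carrier U" for u
    using u y' h' \<delta>_closed[OF u]
    by (simp add: g D_y \<delta>_minus) (simp add: \<delta>_def W.M.minus_eq W.M.a_ac W.M.r_neg1 W.M.r_neg2 W.M.r_neg)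
  ultimately show thesis using that by blast
qed

section \<open>Spans in representations\<close>

lemma submodule_carrier_subset: "submodule H K M \<Longrightarrow> H \<subseteq> carrier M"
  by (auto simp: submodule_def subgroup_def)

text \<open>The library predicate \<open>submodule\<close> only asks for an additive subgroup closed
  under scalars, so it makes sense for left modules over a noncommutative ring.\<close>

lemma (in left_module) left_submoduleI:
  assumes "H \<subseteq> carrier M" "\<zero>\<^bsub>M\<^esub> \<in> H" "\<And>a. a \<in> H \<Longrightarrow> \<ominus>\<^bsub>M\<^esub> a \<in> H"
    "\<And>a b. \<lbrakk>a \<in> H; b \<in> H\<rbrakk> \<Longrightarrow> a \<oplus>\<^bsub>M\<^esub> b \<in> H"
    "\<And>a x. \<lbrakk>a \<in> carrier R; x \<in> H\<rbrakk> \<Longrightarrow> a \<odot>\<^bsub>M\<^esub> x \<in> H"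
  shows "submodule H R M"
  using assms by (intro submodule.intro subgroup.intro submodule_axioms.intro) (auto simp: a_inv_def)

lemma (in left_module) left_submoduleE:
  assumes "submodule H R M"
  shows "\<zero>\<^bsub>M\<^esub> \<in> H" "\<And>a. a \<in> H \<Longrightarrow> \<ominus>\<^bsub>M\<^esub> a \<in> H"
    "\<And>a b. \<lbrakk>a \<in> H; b \<in> H\<rbrakk> \<Longrightarrow> a \<oplus>\<^bsub>M\<^esub> b \<in> H"
    "\<And>a x. \<lbrakk>a \<in> carrier R; x \<in> H\<rbrakk> \<Longrightarrow> a \<odot>\<^bsub>M\<^esub> x \<in> H"
  using assms subgroup.m_inv_closed[of H "add_monoid M"]
  by (auto simp: submodule_def submodule_axioms_def subgroup_def a_inv_def)

lemma (in left_module) carrier_left_submodule: "submodule (carrier M) R M"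
  by (rule left_submoduleI) (auto intro: smult_closed)

text \<open>The carrier is itself one of the intersected submodules, which keeps the intersection
  inside the module.\<close>

lemma (in left_module) submodule_span_submodule:
  assumes "S \<subseteq> carrier M"
  shows "submodule (submodule_span R M S) R M"
  unfolding submodule_span_def
  using assms carrier_left_submodule
  by (intro left_submoduleI) (auto intro: left_submoduleE)

lemma submodule_span_superset: "S \<subseteq> submodule_span K M S"
  by (auto simp: submodule_span_def)

lemma submodule_span_least: "submodule H K M \<Longrightarrow> S \<subseteq> H \<Longrightarrow> submodule_span K M S \<subseteq> H"
  by (auto simp: submodule_span_def)

text \<open>The preimage of \<open>H\<close> is a submodule containing \<open>S\<close>, hence
  contains the span of \<open>S\<close>.\<close>

lemma linear_map_submodule_span:
  assumes "left_module K M" "left_module K N" "linear_map K M N f" "S \<subseteq> carrier M"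
    "submodule H K N" "f ` S \<subseteq> H"
  shows "f ` submodule_span K M S \<subseteq> H"
proof -
  interpret M: left_module K M by fact
  interpret N: left_module K N by fact
  note H = N.left_submoduleE[OF assms(5)]
  have f: "\<And>x. x \<in> carrier M \<Longrightarrow> f x \<in> carrier N"
    and f_add: "\<And>x y. x \<in> carrier M \<Longrightarrow> y \<in> carrier M \<Longrightarrow> f (x \<oplus>\<^bsub>M\<^esub> y) = f x \<oplus>\<^bsub>N\<^esub> f y"
    and f_smult: "\<And>a x. a \<in> carrier K \<Longrightarrow> x \<in> carrier M \<Longrightarrow> f (a \<odot>\<^bsub>M\<^esub> x) = a \<odot>\<^bsub>N\<^esub> f x"
    using assms(3) by (auto simp: linear_map_def)
  have "f \<zero>\<^bsub>M\<^esub> \<oplus>\<^bsub>N\<^esub> f \<zero>\<^bsub>M\<^esub> = f \<zero>\<^bsub>M\<^esub>"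
    using f_add[of "\<zero>\<^bsub>M\<^esub>" "\<zero>\<^bsub>M\<^esub>"] by simp
  then have f0: "f \<zero>\<^bsub>M\<^esub> = \<zero>\<^bsub>N\<^esub>" using f by (simp add: N.M.add.l_cancel_one)
  have f_minus: "f (\<ominus>\<^bsub>M\<^esub> x) = \<ominus>\<^bsub>N\<^esub> f x" if "x \<in> carrier M" for x
  proof -
    have "f (\<ominus>\<^bsub>M\<^esub> x) \<oplus>\<^bsub>N\<^esub> f x = \<zero>\<^bsub>N\<^esub>"
      using that f_add[of "\<ominus>\<^bsub>M\<^esub> x" x] f0 by (simp add: M.M.l_neg)
    then show ?thesis using that f by (intro N.M.minus_equality[symmetric]) auto
  qed
  have "submodule {x \<in> carrier M. f x \<in> H} K M"
    using H f0 f_minus f_add f_smult by (intro M.left_submoduleI) (auto intro: M.smult_closed)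
  then have "submodule_span K M S \<subseteq> {x \<in> carrier M. f x \<in> H}"
    using assms(4,6) by (intro submodule_span_least) auto
  then show ?thesis by auto
qed

section \<open>Images of generators under isometries\<close>

lemma compose_isometries:
  assumes "f \<in> isometries R U V" "g \<in> isometries R V W"
    and "orthogonal_module R U"
  shows "compose (carrier U) g f \<in> isometries R U W"
proof -
  interpret orthogonal_module R U by fact
  show ?thesis
    using isometriesD[OF assms(1)] isometriesD[OF assms(2)]
    by (auto simp: isometries_def linear_map_def compose_def)
qed

lemma id_isometry:
  assumes "orthogonal_module R V"
  shows "(\<lambda>v\<in>carrier V. v) \<in> isometries R V V"
proof -
  interpret orthogonal_module R V by fact
  show ?thesis by (auto simp: isometries_def linear_map_def)
qed

text \<open>The spans on the left, taken for all \<open>W\<close>, form a submodule of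
  \<open>M\<close> by functoriality. It contains the generators because identities are isometries,
  so it is all of \<open>M\<close>.\<close>

lemma (in orI_module) span_of_generators:
  assumes G: "\<And>V x. (V, x) \<in> G \<Longrightarrow> orthogonal_module R V \<and> x \<in> carrier (M V)"
    and gen: "\<And>N. orI_submodule R K M act N \<Longrightarrow> (\<And>V x. (V, x) \<in> G \<Longrightarrow> x \<in> N V) \<Longrightarrow>
      (\<And>V. orthogonal_module R V \<Longrightarrow> N V = carrier (M V))"
    and W: "orthogonal_module R W"
  shows "submodule_span K (M W) {act U W h x |U x h. (U, x) \<in> G \<and> h \<in> isometries R U W} = carrier (M W)"
proof -
  define T where "T W = {act U W h x |U x h. (U, x) \<in> G \<and> h \<in> isometries R U W}" for W
  have T: "T W \<subseteq> carrier (M W)" if "orthogonal_module R W" for W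
    using G linear that by (fastforce simp: T_def linear_map_def)
  have "orI_submodule R K M act (\<lambda>W. submodule_span K (M W) (T W))"
    unfolding orI_submodule_def
  proof (intro conjI allI impI ballI)
    fix V :: "('r, 'v) orthogonal_module" assume "orthogonal_module R V"
    then show "submodule (submodule_span K (M V) (T V)) K (M V)"
      using T left_module by (intro left_module.submodule_span_submodule) auto
  next
    fix V W :: "('r, 'v) orthogonal_module" and f
    assume V: "orthogonal_module R V" and W: "orthogonal_module R W" and f: "f \<in> isometries R V W"
    have "act V W f ` T V \<subseteq> T W"
    proof
      fix z assume "z \<in> act V W f ` T V"
      then obtain U x h where U: "(U, x) \<in> G" and h: "h \<in> isometries R U V"
        and z: "z = act V W f (act U V h x)"
        by (auto simp: T_def)
      have "z = act U W (compose (carrier U) f h) x"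
        unfolding z using G[OF U] V W f h by (intro comp[symmetric]) auto
      then show "z \<in> T W"
        using U compose_isometries[OF h f] G[OF U] by (auto simp: T_def)
    qed
    then show "act V W f ` submodule_span K (M V) (T V) \<subseteq> submodule_span K (M W) (T W)"
      using left_module[OF V] left_module[OF W] linear[OF V W f] T[OF V] T[OF W]
        left_module.submodule_span_submodule[OF left_module[OF W] T[OF W]]
        submodule_span_superset[of "T W" K "M W"]
      by (intro linear_map_submodule_span) auto
  qed
  moreover have "x \<in> submodule_span K (M V) (T V)" if "(V, x) \<in> G" for V x
  proof -
    have "act V V (\<lambda>v\<in>carrier V. v) x = x" using id G[OF that] by blast
    then have "x \<in> T V"
      unfolding T_def using that id_isometry G[OF that] by force
    then show ?thesis by (rule subsetD[OF submodule_span_superset])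
  qed
  ultimately have "submodule_span K (M W) (T W) = carrier (M W)"
    by (rule gen[OF _ _ W])
  then show ?thesis by (simp add: T_def)
qed

section \<open>Spanning by translates of one image when the rank is large\<close>

theorem theorem4p5:
  fixes R :: "('r, 'c) ring_scheme"
    and K :: "('k, 'd) ring_scheme"
    and M :: "('r, 'v) orthogonal_module \<Rightarrow> ('k, 'm) module"
    and act :: "('r, 'v) orthogonal_module \<Rightarrow> ('r, 'v) orthogonal_module \<Rightarrow> ('v \<Rightarrow> 'v) \<Rightarrow> 'm \<Rightarrow> 'm"
  assumes "cring R" and "finite (carrier R)" and "\<one>\<^bsub>R\<^esub> \<oplus>\<^bsub>R\<^esub> \<one>\<^bsub>R\<^esub> \<in> Units R"
    and "ring K"
    and "orI_module R K M act"
    and "finitely_generated R K M act"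
  shows "\<exists>N::nat. \<forall>V W f.
      orthogonal_module R V \<longrightarrow> orthogonal_module R W \<longrightarrow> f \<in> isometries R V W \<longrightarrow> N \<le> rk R V \<longrightarrow>
      submodule_span K (M W)
        (\<Union>g\<in>automorphisms R W. act W W g ` (act V W f ` carrier (M V))) = carrier (M W)"
proof -
  interpret orI_module R K M act by fact
  obtain G where fin: "finite G"
    and G: "\<And>V x. (V, x) \<in> G \<Longrightarrow> orthogonal_module R V \<and> x \<in> carrier (M V)"
    and gen: "\<And>N V. \<lbrakk>orI_submodule R K M act N; \<And>V x. (V, x) \<in> G \<Longrightarrow> x \<in> N V;
      orthogonal_module R V\<rbrakk> \<Longrightarrow> N V = carrier (M V)"
    using assms(6) unfolding finitely_generated_def by (elim exE conjE) fast
  \<comment> \<open>Says that \<open>n\<close> is a sufficient rank for orthogonal copies of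
    \<open>U\<close>; naming it lets one bound be chosen for every \<open>U\<close>.\<close>
  define P where "P U n \<longleftrightarrow> (\<forall>(V :: ('r, 'v) orthogonal_module) (W :: ('r, 'v) orthogonal_module) f h.
    orthogonal_module R V \<longrightarrow> orthogonal_module R W \<longrightarrow> f \<in> isometries R V W \<longrightarrow>
    h \<in> isometries R U W \<longrightarrow> n \<le> rk R V \<longrightarrow>
    (\<exists>k\<in>isometries R U V. \<forall>u\<in>carrier U. \<forall>u'\<in>carrier U. form W (h u) (f (k u')) = \<zero>\<^bsub>R\<^esub>))" for U n
  have "\<exists>n. P U n" if "orthogonal_module R U" for U
    unfolding P_def by (rule orthogonal_copy[OF assms(1-3) that])
  then obtain n where n: "\<And>U. orthogonal_module R U \<Longrightarrow> P U (n U)" by metis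
  \<comment> \<open>The largest of the bounds for the finitely many objects carrying generators;
    \<open>0\<close> covers an empty set of generators.\<close>
  define N where "N = Max (insert 0 ((n \<circ> fst) ` G))"
  have N: "n U \<le> N" if "(U, x) \<in> G" for U x
    unfolding N_def using that fin by (intro Max_ge) (auto intro!: image_eqI[of _ _ "(U, x)"])
  show ?thesis
  proof (intro exI[of _ N] allI impI)
    fix V W :: "('r, 'v) orthogonal_module" and f
    assume V: "orthogonal_module R V" and W: "orthogonal_module R W"
      and f: "f \<in> isometries R V W" and rk: "N \<le> rk R V"
    let ?S = "\<Union>g\<in>automorphisms R W. act W W g ` (act V W f ` carrier (M V))"
    have aut: "automorphisms R W \<subseteq> isometries R W W" by (auto simp: automorphisms_def)
    have S: "?S \<subseteq> carrier (M W)"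
      using linear[OF V W f] linear[OF W W] aut by (fastforce simp: linear_map_def)
    \<comment> \<open>The factorisation \<open>h = g f k\<close> turns the image of a generator
      under \<open>h\<close> into the \<open>g\<close>-translate of a vector in the image of
      \<open>f\<close>.\<close>
    have "act U W h x \<in> ?S" if Ux: "(U, x) \<in> G" and h: "h \<in> isometries R U W" for U x h
    proof -
      have U: "orthogonal_module R U" and x: "x \<in> carrier (M U)" using G[OF Ux] by auto
      have "n U \<le> rk R V" using N[OF Ux] rk by simp
      then obtain k where k: "k \<in> isometries R U V"
        and perp: "\<forall>u\<in>carrier U. \<forall>u'\<in>carrier U. form W (h u) (f (k u')) = \<zero>\<^bsub>R\<^esub>"
        using n[OF U] V W f h unfolding P_def by blast
      let ?y = "compose (carrier U) f k"
      have y: "?y \<in> isometries R U W" by (rule compose_isometries[OF k f U])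
      obtain g where g: "g \<in> automorphisms R W" and gy: "\<And>u. u \<in> carrier U \<Longrightarrow> g (?y u) = h u"
        by (rule automorphism_swapping_orthogonal_copies[OF U W h y])
          (use perp in \<open>auto simp: compose_def\<close>)
      \<comment> \<open>Both sides are extensional, so agreement on the carrier makes them the same
        morphism, to which functoriality applies.\<close>
      have "compose (carrier U) g ?y = h"
      proof (rule extensionalityI)
        show "h \<in> extensional (carrier U)" using h by (simp add: isometries_def)
        show "compose (carrier U) g ?y u = h u" if "u \<in> carrier U" for u
          using gy[OF that] that by (simp add: compose_eq)
      qed (auto simp: compose_def)
      then have "act U W h x = act W W g (act U W ?y x)"
        using comp[OF U W W y _ x, of g] g aut by auto
      also have "act U W ?y x = act V W f (act U V k x)"
        by (rule comp[OF U V W k f x])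
      finally show ?thesis
        using g linear[OF U V k] x by (auto simp: linear_map_def)
    qed
    then have "{act U W h x |U x h. (U, x) \<in> G \<and> h \<in> isometries R U W} \<subseteq> ?S"
      by blast
    then have "submodule_span K (M W) {act U W h x |U x h. (U, x) \<in> G \<and> h \<in> isometries R U W}
        \<subseteq> submodule_span K (M W) ?S"
      by (intro submodule_span_least subset_trans[OF _ submodule_span_superset]
          left_module.submodule_span_submodule[OF left_module[OF W] S])
    moreover have "submodule_span K (M W) {act U W h x |U x h. (U, x) \<in> G \<and> h \<in> isometries R U W}
        = carrier (M W)"
      using G gen W by (rule span_of_generators)
    moreover have "submodule_span K (M W) ?S \<subseteq> carrier (M W)"
      using left_module.submodule_span_submodule[OF left_module[OF W] S]
      by (rule submodule_carrier_subset)
    ultimately show "submodule_span K (M W) ?S = carrier (M W)" by blast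
  qed
qed

end
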